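(* Let $\lambda\in(0,\sqrt2-1)$, $q^0\in\mathbb{R}^{3N}\setminus\Delta$ and $v^0\in\mathbb{R}^{3N}$. Define, for $1\le i<j\le N$, $$M_{ij}(q,\lambda)=\eta(\lambda)\,(K_i(q)+K_j(q)),$$ $$L_{ij}(q,v,\lambda)=\frac{\|v_i-v_j\|}{2\lambda\|q_i-q_j\|}+\sqrt{\left(\frac{\|v_i-v_j\|}{2\lambda\|q_i-q_j\|}\right)^2+\frac{M_{ij}(q,\lambda)}{2\lambda\|q_i-q_j\|}},$$ and $L(q,v,\lambda)=\max_{1\le i<j\le N}L_{ij}(q,v,\lambda)$. Then the solution $(q(t),v(t))$ of the $N$-body equations $$\frac{dq_i}{dt}=v_i,\qquad \frac{dv_i}{dt}=g_i(q),\qquad i=1,\dots,N,$$ with $q(0)=q^0$, $v(0)=v^0$, is uniquely determined as a holomorphic function of $t$ in the closed disk $$D_\lambda(q^0,v^0)=\{t\in\mathbb{C}: |t|\le L(q^0,v^0,\lambda)^{-1}\}.$$ Furthermore, for all $t\in D_\lambda(q^0,v^0)$ and all $1\le i<j\le N$, $$\|q_i(t)-q_j(t)-q_i^0+q_j^0\|\le |t|\,\|v_i^0-v_j^0\|+\frac{|t|^2}{2}M_{ij}(q^0,\lambda),$$ $$\|v_i(t)-v_j(t)-v_i^0+v_j^0\|\le M_{ij}(q^0,\lambda)\,|t|,$$ which in particular implies that $q(t)\in\mathcal{U}_\lambda(q^0)$.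
   Context: $N\ge2$ is an integer, $G>0$ is the gravitational constant and $m_1,\dots,m_N>0$ are masses. Write $q=(q_1,\dots,q_N)$, $v=(v_1,\dots,v_N)$ with $q_i,v_i\in\mathbb{R}^3$ (or $\mathbb{C}^3$), and likewise $q^0=(q^0_1,\dots,q^0_N)$, $v^0=(v^0_1,\dots,v^0_N)$. $\|\cdot\|$ is the Euclidean norm on $\mathbb{R}^3$ (Hermitian norm on $\mathbb{C}^3$), while $u^Tu$ denotes the bilinear expression $\sum_k u_k^2$ (no conjugation). $\Delta=\{q\in\mathbb{R}^{3N}: q_i=q_j\text{ for some }i\ne j\}$. $g_i(q)=\sum_{j\ne i}\dfrac{G m_j}{((q_i-q_j)^T(q_i-q_j))^{3/2}}(q_j-q_i)$, the analytic extension to complex $q$ of the gravitational acceleration $\sum_{j\neq i}\frac{Gm_j}{\|q_i-q_j\|^3}(q_j-q_i)$ (on $\mathcal{U}_\lambda(q^0)$ below, with $\lambda<\sqrt2-1$, the quantities $(q_i-q_j)^T(q_i-q_j)$ have positive real part, and the principal branch of the power is used). $\mathcal{U}_\lambda(q^0)=\{q\in\mathbb{C}^{3N}: \|q_i-q_j-q_i^0+q_j^0\|\le\lambda\|q_i^0-q_j^0\|,\ 1\le i<j\le N\}$. $K_i(q)=\sum_{j\ne i}\dfrac{G m_j}{\|q_i-q_j\|^2}$ and $\eta(\lambda)=\dfrac{1+\lambda}{(1-2\lambda-\lambda^2)^{3/2}}$. *)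

theory Defs
  imports "HOL-Complex_Analysis.Complex_Analysis"
begin

text \<open>
  The \<open>N\<close> bodies are indexed by a finite linearly ordered type \<open>'n\<close>, with \<open>N = CARD('n)\<close>; real
  configurations are of type \<open>real^3^'n\<close> and complex ones of type \<open>complex^3^'n\<close>.
  The norm on \<open>complex^3\<close> is the Hermitian one.
\<close>

definition cvec :: "real^'k \<Rightarrow> complex^'k" where
  "cvec x = (\<chi> k. complex_of_real (x $ k))"

definition bilin_sq :: "complex^'k \<Rightarrow> complex" where
  "bilin_sq u = (\<Sum>k\<in>UNIV. (u $ k)\<^sup>2)"

definition collision_set :: "(real^3^'n) set" where
  "collision_set = {q. \<exists>i j. i \<noteq> j \<and> q $ i = q $ j}"

text \<open>
  \<open>powr\<close> on \<open>complex\<close> is the principal branch. The function is total: at collisions and on the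
  branch cut of some \<open>bilin_sq (q $ i - q $ j)\<close> its values are conventional. Neither occurs in
  \<open>complex_nbhd l q0\<close> below when \<open>0 < l < sqrt 2 - 1\<close> and \<open>q0 \<notin> collision_set\<close>.
\<close>

definition grav_acc :: "real \<Rightarrow> real^'n \<Rightarrow> complex^3^'n \<Rightarrow> 'n::finite \<Rightarrow> complex^3" where
  "grav_acc G m q i =
     (\<Sum>j\<in>UNIV - {i}.
        (complex_of_real (G * m $ j) / bilin_sq (q $ i - q $ j) powr (3 / 2)) *s (q $ j - q $ i))"

definition complex_nbhd :: "real \<Rightarrow> real^3^'n::{finite,linorder} \<Rightarrow> (complex^3^'n::{finite,linorder}) set" where
  "complex_nbhd l q0 =
     {q. \<forall>i j. i < j \<longrightarrow>
        norm (q $ i - q $ j - cvec (q0 $ i) + cvec (q0 $ j)) \<le> l * norm (q0 $ i - q0 $ j)}"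

definition K_fun :: "real \<Rightarrow> real^'n \<Rightarrow> real^3^'n \<Rightarrow> 'n::finite \<Rightarrow> real" where
  "K_fun G m q i = (\<Sum>j\<in>UNIV - {i}. G * m $ j / (norm (q $ i - q $ j))\<^sup>2)"

definition eta :: "real \<Rightarrow> real" where
  "eta l = (1 + l) / (1 - 2 * l - l\<^sup>2) powr (3 / 2)"

definition M_fun :: "real \<Rightarrow> real^'n \<Rightarrow> real^3^'n \<Rightarrow> real \<Rightarrow> 'n::finite \<Rightarrow> 'n \<Rightarrow> real" where
  "M_fun G m q l i j = eta l * (K_fun G m q i + K_fun G m q j)"

definition L_pair ::
  "real \<Rightarrow> real^'n \<Rightarrow> real^3^'n \<Rightarrow> real^3^'n \<Rightarrow> real \<Rightarrow> 'n::finite \<Rightarrow> 'n \<Rightarrow> real" where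
  "L_pair G m q v l i j =
     norm (v $ i - v $ j) / (2 * l * norm (q $ i - q $ j)) +
     sqrt ((norm (v $ i - v $ j) / (2 * l * norm (q $ i - q $ j)))\<^sup>2 +
           M_fun G m q l i j / (2 * l * norm (q $ i - q $ j)))"

definition L_max ::
  "real \<Rightarrow> real^'n::{finite,linorder} \<Rightarrow> real^3^'n::{finite,linorder} \<Rightarrow> real^3^'n::{finite,linorder} \<Rightarrow> real \<Rightarrow> real" where
  "L_max G m q v l = Max {L_pair G m q v l i j | i j. i < j}"

definition time_disk ::
  "real \<Rightarrow> real^'n::{finite,linorder} \<Rightarrow> real^3^'n::{finite,linorder} \<Rightarrow> real^3^'n::{finite,linorder} \<Rightarrow> real \<Rightarrow> complex set" where
  "time_disk G m q0 v0 l = {t. norm t \<le> inverse (L_max G m q0 v0 l)}"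

text \<open>
  Derivatives are taken within \<open>S\<close>: at boundary points of a closed disk they are one-sided, while
  for open \<open>S\<close> they are ordinary complex derivatives.
\<close>

definition holomorphic_solution ::
  "real \<Rightarrow> real^'n \<Rightarrow> real^3^'n \<Rightarrow> real^3^'n \<Rightarrow> complex set \<Rightarrow>
   (complex \<Rightarrow> complex^3^'n) \<Rightarrow> (complex \<Rightarrow> complex^3^'n::finite) \<Rightarrow> bool" where
  "holomorphic_solution G m q0 v0 S q v \<longleftrightarrow>
     (\<forall>i k. (\<lambda>t. q t $ i $ k) holomorphic_on S \<and> (\<lambda>t. v t $ i $ k) holomorphic_on S) \<and>
     (\<forall>t\<in>S. \<forall>i k.
        ((\<lambda>s. q s $ i $ k) has_field_derivative v t $ i $ k) (at t within S) \<and>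
        ((\<lambda>s. v s $ i $ k) has_field_derivative grav_acc G m (q t) i $ k) (at t within S)) \<and>
     (\<forall>i. q 0 $ i = cvec (q0 $ i) \<and> v 0 $ i = cvec (v0 $ i))"

end

theory Submission
  imports Defs
begin

text \<open>
  Three facts combine.

  First, the bilinear square of \<open>q $ i - q $ j\<close> in the neighbourhood differs from
  \<open>(norm (q0 $ i - q0 $ j))\<^sup>2\<close> by at most \<open>2 * l + l\<^sup>2\<close> times this number. Since \<open>l < sqrt 2 - 1\<close>, it has
  positive real part, the field is holomorphic, and each acceleration is bounded by
  \<open>eta l * K_fun G m q0 i\<close> (lemmas \<open>holo_field_nbody\<close> and \<open>norm_grav_acc_le\<close>).

  Secondly, integrating this bound once and twice along the segment from \<open>0\<close> to \<open>t\<close> gives the two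
  estimates of the theorem as long as the solution is in the neighbourhood
  (\<open>pair_deviation_le\<close>). The number \<open>L_max\<close> is such that the position bound does not exceed
  \<open>l * norm (q0 $ i - q0 $ j)\<close> for \<open>norm t \<le> inverse L_max\<close>, and is strictly smaller for smaller times
  (\<open>time_bounds\<close>). A solution on a disk around \<open>0\<close> thus cannot leave the neighbourhood before
  time \<open>inverse L_max\<close> (\<open>solution_stays_near\<close>).

  Thirdly, a holomorphic field that is bounded on balls of a fixed radius around a set \<open>Z\<close> has local
  solutions starting in \<open>Z\<close> on disks of a fixed radius (\<open>local_existence\<close>). A solution on a disk with
  values in \<open>Z\<close> extends to a disk whose radius is larger by that amount (\<open>solution_extends\<close>). With
  the a priori bound of the second step, finitely many extensions lead beyond the radius
  \<open>inverse L_max\<close> (\<open>solution_beyond_radius\<close>), so that the closed disk is covered with room to spare.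
  The room exists although the solution may a priori approach the boundary of the neighbourhood,
  because the field is still bounded on the neighbourhood for some \<open>l'\<close> with \<open>l < l' < sqrt 2 - 1\<close>
  (\<open>nbody_field_bounded_near\<close>).

  Uniqueness on the closed disk follows from local uniqueness at \<open>0\<close>, the identity theorem on the open
  disk, and continuity.
\<close>

\<comment> \<open>Frees the symbol \<open>$\<close> for vector components.\<close>
unbundle no Formal_Power_Series.fps_syntax

section \<open>Holomorphic vector fields and their Lipschitz bounds\<close>

definition holo_curve :: "(complex \<Rightarrow> complex^'k) \<Rightarrow> complex set \<Rightarrow> bool" where
  "holo_curve \<gamma> U \<longleftrightarrow> (\<forall>k. (\<lambda>t. \<gamma> t $ k) holomorphic_on U)"

text \<open>
  Holomorphy of a vector field in several variables, expressed through curves. Complex lines as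
  test curves yield Lipschitz estimates, and arbitrary test curves make the right-hand side of
  the equation holomorphic along a Picard iterate.
\<close>
definition holo_field :: "(complex^'k \<Rightarrow> complex^'k) \<Rightarrow> (complex^'k) set \<Rightarrow> bool" where
  "holo_field F W \<longleftrightarrow>
     (\<forall>\<gamma> U. open U \<longrightarrow> holo_curve \<gamma> U \<longrightarrow> \<gamma> ` U \<subseteq> W \<longrightarrow> holo_curve (\<lambda>t. F (\<gamma> t)) U)"

text \<open>
  The derivatives are two-sided, so that \<open>S\<close> is meant to be an open set of times.
\<close>
definition solves :: "(complex^'k \<Rightarrow> complex^'k) \<Rightarrow> (complex \<Rightarrow> complex^'k) \<Rightarrow> complex set \<Rightarrow> bool" where
  "solves F y S \<longleftrightarrow> (\<forall>t\<in>S. \<forall>k. ((\<lambda>s. y s $ k) has_field_derivative F (y t) $ k) (at t))"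

text \<open>
  The radius is \<open>2 * d\<close> because Cauchy's inequality at points of \<open>ball z d\<close> needs a margin \<open>d\<close>.
  Bounds of this kind with \<open>d\<close> and \<open>B\<close> independent of \<open>z\<close> give existence times independent of \<open>z\<close>.
\<close>
definition bounded_on_ball :: "(complex^'k \<Rightarrow> complex^'k) \<Rightarrow> (complex^'k) set \<Rightarrow> real \<Rightarrow> real \<Rightarrow> complex^'k \<Rightarrow> bool" where
  "bounded_on_ball F W d B z \<longleftrightarrow> ball z (2 * d) \<subseteq> W \<and> (\<forall>w\<in>ball z (2 * d). \<forall>k. norm (F w $ k) \<le> B)"

lemma norm_le_CARD_mult:
  fixes x :: "complex^'k" and b :: real
  assumes "\<And>k. norm (x $ k) \<le> b"
  shows "norm x \<le> CARD('k) * b"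
proof -
  have "norm x \<le> (\<Sum>k\<in>UNIV. norm (x $ k))"
    unfolding norm_vec_def by (rule L2_set_le_sum) auto
  also have "\<dots> \<le> of_nat (card (UNIV :: 'k set)) * b"
    using assms by (intro sum_bounded_above) auto
  finally show ?thesis by simp
qed

lemma norm_vector_smult:
  fixes x :: "complex^'k"
  shows "norm (c *s x) = norm c * norm x"
  unfolding norm_vec_def by (simp add: norm_mult L2_set_right_distrib)

lemma of_real_vector_smult:
  fixes x :: "complex^'k"
  shows "complex_of_real r *s x = r *\<^sub>R x"
  by (simp add: vec_eq_iff) (simp add: scaleR_conv_of_real)

text \<open>
  Along the complex line through \<open>w1\<close> and \<open>w2\<close> the field is a holomorphic function of one variable.
  It is bounded on the disk of radius \<open>d / norm (w1 - w2)\<close> around each parameter in \<open>[0, 1]\<close>, and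
  Cauchy's inequality bounds its derivative there.
\<close>
lemma lipschitz_of_bounded:
  assumes F: "holo_field F W" and bd: "bounded_on_ball F W d B z"
    and "d > 0" and w1: "w1 \<in> ball z d" and w2: "w2 \<in> ball z d"
  shows "norm (F w1 $ k - F w2 $ k) \<le> 2 * B / d * norm (w1 - w2)"
proof (cases "w1 = w2")
  case False
  define e where "e = norm (w2 - w1)"
  have e: "e > 0" using False by (simp add: e_def)
  define \<gamma> where "\<gamma> s = w1 + s *s (w2 - w1)" for s :: complex
  define U where "U = (\<Union>s0\<in>{0..1::real}. ball (complex_of_real s0) (d / e))"
  have in2: "\<gamma> s \<in> ball z (2 * d)" if "s \<in> U" for s
  proof -
    obtain s0 where s0: "s0 \<in> {0..1}" "norm (s - of_real s0) < d / e"
      using \<open>s \<in> U\<close> by (auto simp: U_def dist_norm norm_minus_commute)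
    have "\<gamma> (of_real s0) = (1 - s0) *\<^sub>R w1 + s0 *\<^sub>R w2"
      unfolding \<gamma>_def of_real_vector_smult by (simp add: algebra_simps)
    then have "\<gamma> (of_real s0) \<in> ball z d"
      using convex_ball[of z d, unfolded convex_alt] w1 w2 s0 by auto
    moreover have "\<gamma> s - \<gamma> (of_real s0) = (s - of_real s0) *s (w2 - w1)"
      by (simp add: \<gamma>_def vec_eq_iff algebra_simps)
    then have "norm (\<gamma> s - \<gamma> (of_real s0)) < d"
      using s0 e by (simp only: norm_vector_smult e_def[symmetric] pos_less_divide_eq)
    ultimately show ?thesis
      using dist_triangle[of z "\<gamma> s" "\<gamma> (of_real s0)"] by (simp add: dist_norm norm_minus_commute)
  qed
  have "open U" unfolding U_def by auto
  moreover have "holo_curve \<gamma> U"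
    unfolding holo_curve_def \<gamma>_def by (auto intro!: holomorphic_intros)
  moreover have "\<gamma> ` U \<subseteq> W"
    using in2 bd by (auto simp: bounded_on_ball_def)
  ultimately have hol: "(\<lambda>s. F (\<gamma> s) $ k) holomorphic_on U"
    using F unfolding holo_field_def holo_curve_def by blast
  define g where "g = (\<lambda>s. F (\<gamma> s) $ k)"
  have seg: "\<exists>s0\<in>{0..1}. s = complex_of_real s0" if "s \<in> closed_segment 0 1" for s :: complex
    using that by (auto simp: in_segment scaleR_conv_of_real)
  have der: "norm (deriv g s) \<le> 2 * B / d * e" "(g has_field_derivative deriv g s) (at s)"
    if "s \<in> closed_segment 0 1" for s
  proof -
    obtain s0 where s0: "s0 \<in> {0..1}" "s = complex_of_real s0" using seg[OF \<open>s \<in> _\<close>] by auto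
    have sub: "ball s (d / e) \<subseteq> U" using s0 by (auto simp: U_def)
    have sub2: "cball s (d / (2 * e)) \<subseteq> ball s (d / e)"
      using \<open>d > 0\<close> e by (auto simp: field_simps)
    have holg: "g holomorphic_on ball s (d / e)" using holomorphic_on_subset[OF hol sub] by (simp add: g_def)
    have "norm ((deriv ^^ 1) g s) \<le> fact 1 * B / (d / (2 * e)) ^ 1"
    proof (rule Cauchy_inequality)
      show "g holomorphic_on ball s (d / (2 * e))"
        using holg sub2 ball_subset_cball by (meson holomorphic_on_subset order_trans)
      show "continuous_on (cball s (d / (2 * e))) g"
        using holg sub2 holomorphic_on_imp_continuous_on holomorphic_on_subset by blast
      show "0 < d / (2 * e)" using \<open>d > 0\<close> e by simp
      fix x assume "norm (s - x) = d / (2 * e)"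
      then have "x \<in> cball s (d / (2 * e))" by (simp add: dist_norm)
      then have "x \<in> U" using sub sub2 by blast
      then show "norm (g x) \<le> B" using in2 bd by (auto simp: g_def bounded_on_ball_def)
    qed
    then show "norm (deriv g s) \<le> 2 * B / d * e" by (simp add: field_simps)
    show "(g has_field_derivative deriv g s) (at s)"
      using holg \<open>d > 0\<close> e by (intro holomorphic_derivI) auto
  qed
  have "norm (g 0 - g 1) \<le> (2 * B / d * e) * norm (0 - 1 :: complex)"
    by (rule field_differentiable_bound[where S = "closed_segment 0 1" and f' = "deriv g"])
       (use der in \<open>auto intro: has_field_derivative_at_within\<close>)
  then show ?thesis by (simp add: g_def \<gamma>_def e_def norm_minus_commute)
qed auto

lemma continuous_on_vec_components:
  fixes y :: "'a::topological_space \<Rightarrow> 'b::topological_space^'k"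
  assumes "\<And>k. continuous_on S (\<lambda>t. y t $ k)"
  shows "continuous_on S y"
  using assms unfolding continuous_on_def by (auto intro: vec_tendstoI)

lemma solves_holo_curve: "solves F y S \<Longrightarrow> holo_curve y S"
  unfolding solves_def holo_curve_def
  by (metis field_differentiable_at_within field_differentiable_def holomorphic_onI)

lemma holo_curve_continuous: "holo_curve y S \<Longrightarrow> continuous_on S y"
  by (auto simp: holo_curve_def intro!: continuous_on_vec_components holomorphic_on_imp_continuous_on)

section \<open>Local existence and uniqueness\<close>

text \<open>
  Picard iteration, with each iterate obtained from a primitive on the convex disk. On a disk of
  this radius all iterates after the constant one remain within \<open>d / 4\<close> of \<open>z\<close>, and the Lipschitz constant
  \<open>2 * B / d\<close> makes successive differences shrink by the factor \<open>1 / 2\<close>. The factor \<open>CARD('k)\<close> pays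
  for estimating the norm by the components. The time \<open>d / (4 * CARD('k) * B)\<close> depends on \<open>z\<close> only
  through \<open>d\<close> and \<open>B\<close>, which is what allows continuation past a fixed radius.
\<close>
lemma local_existence:
  fixes F :: "complex^'k \<Rightarrow> complex^'k" and d B :: real
  assumes F: "holo_field F W" and bd: "bounded_on_ball F W d B z"
    and "d > 0" "B > 0"
  shows "\<exists>y. solves F y (ball p (d / (4 * real CARD('k) * B))) \<and> y p = z"
proof -
  define c where "c = real CARD('k)"
  define \<epsilon> where "\<epsilon> = d / (4 * c * B)"
  define D where "D = ball p \<epsilon>"
  have c: "c > 0" by (simp add: c_def)
  have \<epsilon>: "\<epsilon> > 0" using assms c by (simp add: \<epsilon>_def)
  have norm_le: "norm x \<le> c * b" if "\<And>k. norm (x $ k) \<le> b" for b and x :: "complex^'k"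
    using norm_le_CARD_mult[OF that] by (simp add: c_def)
  have D: "open D" "convex D" "p \<in> D" using \<epsilon> by (auto simp: D_def)
  have half: "cball z (d / 2) \<subseteq> ball z d" "ball z d \<subseteq> ball z (2 * d)" using \<open>d > 0\<close> by auto
  define P where "P = (\<lambda>(n::nat) y. holo_curve y D \<and> y ` D \<subseteq> cball z (d / 2) \<and> y p = z)"
  define Q where "Q = (\<lambda>(n::nat) (y::complex \<Rightarrow> complex^'k) y'.
      \<forall>t\<in>D. \<forall>k. ((\<lambda>s. y' s $ k) has_field_derivative F (y t) $ k) (at t))"
  have "\<exists>f. \<forall>n. P n (f n) \<and> Q n (f n) (f (Suc n))"
  proof (rule dependent_nat_choice)
    show "\<exists>y. P 0 y"
      using \<open>d > 0\<close> by (intro exI[of _ "\<lambda>t. z"]) (auto simp: P_def holo_curve_def)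
  next
    fix y n assume y: "P n y"
    then have "y ` D \<subseteq> W" "holo_curve y D"
      using half bd unfolding P_def bounded_on_ball_def by blast+
    then have hol: "(\<lambda>t. F (y t) $ k) holomorphic_on D" for k
      using F D unfolding holo_field_def holo_curve_def by blast
    have "\<exists>h. \<forall>t\<in>D. (h has_field_derivative F (y t) $ k) (at t)" for k
      using holomorphic_convex_primitive'[OF D(2,1) hol[of k]] D(1)
      by (metis at_within_open)
    then obtain h where h: "\<And>k t. t \<in> D \<Longrightarrow> (h k has_field_derivative F (y t) $ k) (at t)"
      by metis
    define y' where "y' t = (\<chi> k. z $ k + (h k t - h k p))" for t
    have der: "((\<lambda>s. y' s $ k) has_field_derivative F (y t) $ k) (at t)" if "t \<in> D" for t k
      unfolding y'_def using h[OF that, of k] by (auto intro!: derivative_eq_intros)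
    have "norm (y' t - z) \<le> d / 2" if "t \<in> D" for t
    proof -
      have "norm ((y' t - z) $ k) \<le> B * \<epsilon>" for k
      proof -
        have "norm (h k t - h k p) \<le> B * norm (t - p)"
        proof (rule field_differentiable_bound[OF D(2), where f = "h k" and f' = "\<lambda>s. F (y s) $ k"])
          fix s assume s: "s \<in> D"
          show "(h k has_field_derivative F (y s) $ k) (at s within D)"
            using h[OF s] by (rule has_field_derivative_at_within)
          have "y s \<in> ball z (2 * d)" using y s half unfolding P_def by blast
          then show "norm (F (y s) $ k) \<le> B" using bd by (auto simp: bounded_on_ball_def)
        qed (use that D in auto)
        also have "\<dots> \<le> B * \<epsilon>"
          using that \<open>B > 0\<close> by (auto simp: D_def dist_norm norm_minus_commute)
        finally show ?thesis by (simp add: y'_def)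
      qed
      from norm_le[OF this] show ?thesis
        using c \<open>B > 0\<close> \<open>d > 0\<close> by (simp add: \<epsilon>_def field_simps)
    qed
    moreover have "holo_curve y' D"
      unfolding holo_curve_def using der
      by (metis field_differentiable_at_within field_differentiable_def holomorphic_onI)
    ultimately have "P (Suc n) y'"
      by (auto simp: P_def dist_norm norm_minus_commute y'_def)
    then show "\<exists>y'. P (Suc n) y' \<and> Q n y y'" using der by (auto simp: Q_def)
  qed
  then obtain f where P: "\<And>n. P n (f n)" and Q: "\<And>n. Q n (f n) (f (Suc n))" by auto
  have fball: "f n t \<in> cball z (d / 2)" if "t \<in> D" for n t
    using P[of n] that by (auto simp: P_def)
  have fp: "f n p = z" for n using P[of n] by (simp add: P_def)
  have fder: "((\<lambda>s. f (Suc n) s $ k) has_field_derivative F (f n t) $ k) (at t)" if "t \<in> D" for n t k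
    using Q[of n] that unfolding Q_def by blast
  have step: "norm (f (Suc n) t - f n t) \<le> 2 * d / 2 ^ n" if "t \<in> D" for n t
    using that
  proof (induction n arbitrary: t)
    case 0
    have "dist z (f n t) < d" for n using subsetD[OF half(1) fball[OF 0]] by simp
    from this[of 0] this[of 1] have "dist (f 1 t) (f 0 t) < 2 * d"
      using dist_triangle3[of "f 1 t" "f 0 t" z] by linarith
    then show ?case by (simp add: dist_norm)
  next
    case (Suc n)
    have "norm ((f (Suc (Suc n)) t - f (Suc n) t) $ k) \<le> d / (c * 2 ^ n)" for k
    proof -
      define u where "u = (\<lambda>t. f (Suc (Suc n)) t $ k - f (Suc n) t $ k)"
      have "norm (u t - u p) \<le> (2 * B / d * (2 * d / 2 ^ n)) * norm (t - p)"
      proof (rule field_differentiable_bound[OF D(2), where f = u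
            and f' = "\<lambda>s. F (f (Suc n) s) $ k - F (f n s) $ k"])
        fix s assume s: "s \<in> D"
        show "(u has_field_derivative F (f (Suc n) s) $ k - F (f n s) $ k) (at s within D)"
          unfolding u_def
          by (rule has_field_derivative_at_within) (intro DERIV_diff fder s)
        have "f (Suc n) s \<in> ball z d" "f n s \<in> ball z d"
          using subsetD[OF half(1) fball[OF s]] by blast+
        then have "norm (F (f (Suc n) s) $ k - F (f n s) $ k) \<le> 2 * B / d * norm (f (Suc n) s - f n s)"
          by (rule lipschitz_of_bounded[OF F bd \<open>d > 0\<close>])
        also have "\<dots> \<le> 2 * B / d * (2 * d / 2 ^ n)"
          by (rule mult_left_mono[OF Suc.IH[OF s]]) (use \<open>d > 0\<close> \<open>B > 0\<close> in simp)
        finally show "norm (F (f (Suc n) s) $ k - F (f n s) $ k) \<le> 2 * B / d * (2 * d / 2 ^ n)" .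
      qed (rule Suc.prems D(3))+
      also have "\<dots> \<le> (2 * B / d * (2 * d / 2 ^ n)) * \<epsilon>"
        using Suc.prems \<open>d > 0\<close> \<open>B > 0\<close>
        by (intro mult_left_mono) (auto simp: D_def dist_norm norm_minus_commute)
      also have "\<dots> = d / (c * 2 ^ n)" using c \<open>d > 0\<close> \<open>B > 0\<close> by (simp add: \<epsilon>_def field_simps)
      finally show ?thesis by (simp add: u_def fp)
    qed
    from norm_le[OF this] show ?case using c by (simp add: field_simps)
  qed
  have "\<exists>S. uniform_limit D (\<lambda>n t. f n t $ k) S sequentially" for k
  proof -
    have "uniform_limit D (\<lambda>n t. \<Sum>i<n. f (Suc i) t $ k - f i t $ k)
            (\<lambda>t. suminf (\<lambda>i. f (Suc i) t $ k - f i t $ k)) sequentially"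
    proof (rule Weierstrass_m_test)
      show "norm (f (Suc n) t $ k - f n t $ k) \<le> 2 * d * (1 / 2) ^ n" if "t \<in> D" for n t
        using order_trans[OF Finite_Cartesian_Product.norm_nth_le[of "f (Suc n) t - f n t" k] step[OF that]]
        by (simp add: power_one_over)
      show "summable (\<lambda>n. 2 * d * (1 / 2) ^ n)" by (intro summable_mult summable_geometric) auto
    qed
    also have "(\<lambda>n t. \<Sum>i<n. f (Suc i) t $ k - f i t $ k) = (\<lambda>n t. f n t $ k - f 0 t $ k)"
      by (intro ext sum_lessThan_telescope)
    finally have "uniform_limit D (\<lambda>n t. (f n t $ k - f 0 t $ k) + f 0 t $ k)
        (\<lambda>t. suminf (\<lambda>i. f (Suc i) t $ k - f i t $ k) + f 0 t $ k) sequentially"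
      by (rule uniform_limit_add[OF _ uniform_limit_const])
    then show ?thesis by auto
  qed
  then obtain S where S: "\<And>k. uniform_limit D (\<lambda>n t. f n t $ k) (S k) sequentially" by metis
  define y where "y t = (\<chi> k. S k t)" for t
  have lim: "(\<lambda>n. f n t) \<longlonglongrightarrow> y t" if "t \<in> D" for t
    using tendsto_uniform_limitI[OF S that] by (intro vec_tendstoI) (simp add: y_def)
  have yball: "y t \<in> cball z (d / 2)" if "t \<in> D" for t
    by (rule closed_sequentially[OF closed_cball fball[OF that] lim[OF that]])
  have "((\<lambda>s. y s $ k) has_field_derivative F (y t) $ k) (at t)" if t: "t \<in> D" for t k
  proof -
    \<comment> \<open>Locally uniform limits commute with complex differentiation. The limit of the derivatives is then
    identified by continuity of the field.\<close>
    have "\<exists>g'. \<forall>x\<in>D. ((\<lambda>s. y s $ k) has_field_derivative g' x) (at x) \<and>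
            (\<lambda>n. F (f n x) $ k) \<longlonglongrightarrow> g' x"
    proof (rule has_complex_derivative_uniform_sequence[OF D(1), where f = "\<lambda>n t. f (Suc n) t $ k"])
      show "((\<lambda>t. f (Suc n) t $ k) has_field_derivative F (f n x) $ k) (at x)" if "x \<in> D" for n x
        using that by (rule fder)
      fix x assume "x \<in> D"
      then obtain e where e: "e > 0" "cball x e \<subseteq> D" using D(1) open_contains_cball by blast
      have "uniform_limit D (\<lambda>n t. f (Suc n) t $ k) (S k) sequentially"
        using filterlim_compose[OF S filterlim_Suc, of k] by simp
      with e show "\<exists>e>0. cball x e \<subseteq> D \<and>
          uniform_limit (cball x e) (\<lambda>n t. f (Suc n) t $ k) (\<lambda>s. y s $ k) sequentially"
        by (auto simp: y_def intro: uniform_limit_on_subset)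
    qed
    then obtain g' where g': "((\<lambda>s. y s $ k) has_field_derivative g') (at t)"
        "(\<lambda>n. F (f n t) $ k) \<longlonglongrightarrow> g'" using t by metis
    have "(\<lambda>n. F (f n t) $ k) \<longlonglongrightarrow> F (y t) $ k"
    proof (rule Lim_transform_bound[where g = "\<lambda>n. 2 * B / d * norm (f n t - y t)", THEN Lim_null[THEN iffD2]])
      show "\<forall>\<^sub>F n in sequentially. norm (F (f n t) $ k - F (y t) $ k) \<le> norm (2 * B / d * norm (f n t - y t))"
        using lipschitz_of_bounded[OF F bd \<open>d > 0\<close> subsetD[OF half(1) fball[OF t]] subsetD[OF half(1) yball[OF t]], of _ k]
          \<open>d > 0\<close> \<open>B > 0\<close>
        by (intro always_eventually allI) (simp add: abs_mult)
      show "(\<lambda>n. 2 * B / d * norm (f n t - y t)) \<longlonglongrightarrow> 0"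
        by (intro tendsto_mult_right_zero tendsto_norm_zero LIM_zero lim t)
    qed
    with g' show ?thesis using LIMSEQ_unique by blast
  qed
  moreover have "y p = z" using lim[OF D(3)] fp by (simp add: LIMSEQ_const_iff)
  ultimately show ?thesis
    unfolding solves_def D_def \<epsilon>_def c_def by blast
qed

text \<open>
  If \<open>N\<close> is the maximum of the distance of the two solutions on a sufficiently small disk, then
  integrating the Lipschitz estimate gives \<open>N \<le> N / 2\<close>.
\<close>
lemma local_uniqueness:
  fixes F :: "complex^'k \<Rightarrow> complex^'k" and d B :: real
  assumes F: "holo_field F W" and bd: "bounded_on_ball F W d B (y1 p)"
    and "d > 0" "B > 0" and "open S" "p \<in> S"
    and y1: "solves F y1 S" and y2: "solves F y2 S" and eq: "y1 p = y2 p"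
  shows "\<exists>\<delta>>0. ball p \<delta> \<subseteq> S \<and> (\<forall>t\<in>ball p \<delta>. y1 t = y2 t)"
proof -
  define c where "c = real CARD('k)"
  have c: "c > 0" by (simp add: c_def)
  have cont: "continuous_on S y1" "continuous_on S y2"
    using y1 y2 solves_holo_curve holo_curve_continuous by blast+
  have "open (S \<inter> y1 -` ball (y1 p) d)" "open (S \<inter> y2 -` ball (y1 p) d)"
    using cont \<open>open S\<close> by (auto intro!: continuous_open_preimage)
  moreover have "p \<in> (S \<inter> y1 -` ball (y1 p) d) \<inter> (S \<inter> y2 -` ball (y1 p) d)"
    using \<open>p \<in> S\<close> \<open>d > 0\<close> eq by auto
  ultimately obtain e where e: "e > 0"
      "cball p e \<subseteq> (S \<inter> y1 -` ball (y1 p) d) \<inter> (S \<inter> y2 -` ball (y1 p) d)"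
    by (meson open_Int open_contains_cball)
  define \<delta> where "\<delta> = min e (d / (4 * c * B))"
  have \<delta>: "\<delta> > 0" using e c assms by (simp add: \<delta>_def)
  define K where "K = cball p \<delta>"
  have K: "K \<subseteq> S" and in1: "\<And>t. t \<in> K \<Longrightarrow> y1 t \<in> ball (y1 p) d" "\<And>t. t \<in> K \<Longrightarrow> y2 t \<in> ball (y1 p) d"
  proof -
    have "K \<subseteq> cball p e" by (simp add: K_def \<delta>_def subset_cball)
    with e(2) have "K \<subseteq> (S \<inter> y1 -` ball (y1 p) d) \<inter> (S \<inter> y2 -` ball (y1 p) d)" by (rule order_trans[rotated])
    then show "K \<subseteq> S" "\<And>t. t \<in> K \<Longrightarrow> y1 t \<in> ball (y1 p) d" "\<And>t. t \<in> K \<Longrightarrow> y2 t \<in> ball (y1 p) d"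
      by blast+
  qed
  have "continuous_on K (\<lambda>t. norm (y1 t - y2 t))"
    using cont K by (intro continuous_intros) (auto intro: continuous_on_subset)
  moreover have "compact K" "K \<noteq> {}" using \<delta> by (auto simp: K_def)
  ultimately obtain t1 where t1: "t1 \<in> K" "\<And>t. t \<in> K \<Longrightarrow> norm (y1 t - y2 t) \<le> norm (y1 t1 - y2 t1)"
    using continuous_attains_sup[of K "\<lambda>t. norm (y1 t - y2 t)"] by blast
  define N where "N = norm (y1 t1 - y2 t1)"
  have "norm ((y1 t1 - y2 t1) $ k) \<le> N / (2 * c)" for k
  proof -
    define u where "u = (\<lambda>t. y1 t $ k - y2 t $ k)"
    have "norm (u t1 - u p) \<le> (2 * B / d * N) * norm (t1 - p)"
    proof (rule field_differentiable_bound[where S = K and f = u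
          and f' = "\<lambda>s. F (y1 s) $ k - F (y2 s) $ k"])
      fix s assume s: "s \<in> K"
      show "(u has_field_derivative F (y1 s) $ k - F (y2 s) $ k) (at s within K)"
        unfolding u_def using y1 y2 subsetD[OF K s]
        by (intro has_field_derivative_at_within[OF DERIV_diff]) (simp_all only: solves_def)
      have "norm (F (y1 s) $ k - F (y2 s) $ k) \<le> 2 * B / d * norm (y1 s - y2 s)"
        using in1[OF s] by (rule lipschitz_of_bounded[OF F bd \<open>d > 0\<close>])
      also have "\<dots> \<le> 2 * B / d * N"
        using t1(2)[OF s] \<open>d > 0\<close> \<open>B > 0\<close> by (intro mult_left_mono) (auto simp: N_def)
      finally show "norm (F (y1 s) $ k - F (y2 s) $ k) \<le> 2 * B / d * N" .
    qed (use t1 \<delta> in \<open>auto simp: K_def\<close>)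
    also have "\<dots> \<le> (2 * B / d * N) * (d / (4 * c * B))"
      using t1(1) \<open>d > 0\<close> \<open>B > 0\<close>
      by (intro mult_left_mono) (auto simp: K_def \<delta>_def dist_norm norm_minus_commute N_def)
    also have "\<dots> = N / (2 * c)" using c \<open>d > 0\<close> \<open>B > 0\<close> by (simp add: field_simps)
    finally show ?thesis by (simp add: u_def eq)
  qed
  from norm_le_CARD_mult[OF this] have "N \<le> N / 2" using c by (simp add: N_def c_def)
  then have "N \<le> 0" by simp
  then have "y1 t = y2 t" if "t \<in> K" for t
    using t1(2)[OF that] by (simp add: N_def)
  then show ?thesis using \<delta> K by (intro exI[of _ \<delta>]) (auto simp: K_def)
qed

lemma curves_eq_of_eq_on_open:
  assumes "open T" "open S" "connected S" "T \<noteq> {}" "T \<subseteq> S" "holo_curve y1 S" "holo_curve y2 S"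
    and "\<And>t. t \<in> T \<Longrightarrow> y1 t = y2 t" and "t \<in> S"
  shows "y1 t = y2 t"
proof -
  have "y1 t $ k = y2 t $ k" for k
    by (rule analytic_continuation_open[of T S "\<lambda>t. y1 t $ k" "\<lambda>t. y2 t $ k"])
       (use assms in \<open>auto simp: holo_curve_def\<close>)
  then show ?thesis by (simp add: vec_eq_iff)
qed

lemma solves_subset: "solves F y S \<Longrightarrow> T \<subseteq> S \<Longrightarrow> solves F y T"
  by (auto simp: solves_def)

text \<open>
  The field is controlled only near the initial value. Away from \<open>p\<close> the identity theorem replaces
  the differential equation, and so \<open>y2\<close> may take values where nothing is known about \<open>F\<close>.
\<close>
lemma uniqueness:
  assumes "holo_field F W" "bounded_on_ball F W d B (y1 p)" "d > 0" "B > 0"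
    and S: "open S" "connected S" "p \<in> S"
    and y: "solves F y1 S" "solves F y2 S" "y1 p = y2 p" and "t \<in> S"
  shows "y1 t = y2 t"
proof -
  obtain \<delta> where "\<delta> > 0" "ball p \<delta> \<subseteq> S" "\<forall>t\<in>ball p \<delta>. y1 t = y2 t"
    using local_uniqueness[OF assms(1-4) S(1,3) y] by auto
  then show ?thesis
    using curves_eq_of_eq_on_open[of "ball p \<delta>" S y1 y2 t] S y \<open>t \<in> S\<close>
    by (auto dest: solves_holo_curve)
qed

section \<open>Continuation past a given radius\<close>

text \<open>
  Every point of \<open>ball 0 r\<close> carries a local solution on a disk of the same radius \<open>\<epsilon>\<close>, and these disks
  cover \<open>ball 0 (r + \<epsilon>)\<close>. They can be glued without monodromy: if two of them meet, then the midpoint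
  of their centres lies in both and in \<open>ball 0 r\<close>, where both local solutions coincide with \<open>y\<close>.
\<close>
lemma solution_extends:
  fixes F :: "complex^'k \<Rightarrow> complex^'k" and d B :: real
  assumes F: "holo_field F W" and bd: "\<And>z. z \<in> Z \<Longrightarrow> bounded_on_ball F W d B z"
    and "d > 0" "B > 0" and "r > 0"
    and y: "solves F y (ball 0 r)" and Z: "y ` ball 0 r \<subseteq> Z"
  shows "\<exists>Y. solves F Y (ball 0 (r + d / (4 * real CARD('k) * B))) \<and> Y 0 = y 0"
proof -
  define \<epsilon> where "\<epsilon> = d / (4 * real CARD('k) * B)"
  have \<epsilon>: "\<epsilon> > 0" using assms by (simp add: \<epsilon>_def)
  have bdy: "bounded_on_ball F W d B (y p)" if "p \<in> ball 0 r" for p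
    using bd Z that by blast
  obtain u where u: "\<And>p. p \<in> ball 0 r \<Longrightarrow> solves F (u p) (ball p \<epsilon>)"
      and up: "\<And>p. p \<in> ball 0 r \<Longrightarrow> u p p = y p"
  proof -
    have "\<forall>p\<in>ball 0 r. \<exists>u. solves F u (ball p \<epsilon>) \<and> u p = y p"
      using local_existence[OF F bdy \<open>d > 0\<close> \<open>B > 0\<close>] unfolding \<epsilon>_def by blast
    then show ?thesis using that by metis
  qed
  have uy: "u p t = y t" if p: "p \<in> ball 0 r" and t: "t \<in> ball p \<epsilon>" "t \<in> ball 0 r" for p t
  proof (rule uniqueness[OF F _ \<open>d > 0\<close> \<open>B > 0\<close>, where S = "ball p \<epsilon> \<inter> ball 0 r" and p = p])
    show "bounded_on_ball F W d B (u p p)" using bdy[OF p] up[OF p] by simp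
    show "connected (ball p \<epsilon> \<inter> ball 0 r)" by (intro convex_connected convex_Int convex_ball)
    show "solves F (u p) (ball p \<epsilon> \<inter> ball 0 r)" "solves F y (ball p \<epsilon> \<inter> ball 0 r)"
      using u[OF p] y by (auto intro: solves_subset)
  qed (use p t \<epsilon> up in auto)
  have uu: "u p1 t = u p2 t" if p: "p1 \<in> ball 0 r" "p2 \<in> ball 0 r" and t: "t \<in> ball p1 \<epsilon>" "t \<in> ball p2 \<epsilon>" for p1 p2 t
  proof (rule curves_eq_of_eq_on_open[of "ball p1 \<epsilon> \<inter> ball p2 \<epsilon> \<inter> ball 0 r" "ball p1 \<epsilon> \<inter> ball p2 \<epsilon>"])
    have "dist p1 p2 < 2 * \<epsilon>"
      using t dist_triangle2[of p1 p2 t] by simp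
    then have "midpoint p1 p2 \<in> ball p1 \<epsilon> \<inter> ball p2 \<epsilon>"
      by (auto simp: dist_midpoint)
    moreover have "midpoint p1 p2 \<in> ball 0 r"
      using p convex_contains_segment[of "ball 0 r"] midpoint_in_closed_segment by blast
    ultimately show "ball p1 \<epsilon> \<inter> ball p2 \<epsilon> \<inter> ball 0 r \<noteq> {}" by blast
    show "connected (ball p1 \<epsilon> \<inter> ball p2 \<epsilon>)" by (intro convex_connected convex_Int convex_ball)
    show "holo_curve (u p1) (ball p1 \<epsilon> \<inter> ball p2 \<epsilon>)" "holo_curve (u p2) (ball p1 \<epsilon> \<inter> ball p2 \<epsilon>)"
      using u p by (meson solves_subset solves_holo_curve inf_le1 inf_le2)+
  qed (use p t uy in auto)
  define c where "c t = (SOME p. p \<in> ball (0 :: complex) r \<and> t \<in> ball p \<epsilon>)" for t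
  define Y where "Y t = u (c t) t" for t
  have Yu: "Y t = u p t" if "p \<in> ball 0 r" "t \<in> ball p \<epsilon>" for p t
  proof -
    have "c t \<in> ball 0 r \<and> t \<in> ball (c t) \<epsilon>"
      unfolding c_def by (rule someI[of _ p]) (use that in auto)
    then show ?thesis using uu[of "c t" p t] that by (simp add: Y_def)
  qed
  have "((\<lambda>s. Y s $ k) has_field_derivative F (Y t) $ k) (at t)" if t: "t \<in> ball 0 (r + \<epsilon>)" for t k
  proof -
    have "\<exists>p\<in>ball 0 r. t \<in> ball p \<epsilon>"
    proof -
      \<comment> \<open>Shrinking by this factor carries \<open>ball 0 (r + \<epsilon>)\<close> onto \<open>ball 0 r\<close>
      and moves no point by \<open>\<epsilon>\<close> or more.\<close>
      define p where "p = (r / (r + \<epsilon>)) *\<^sub>R t"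
      have "norm p = r / (r + \<epsilon>) * norm t" using \<open>r > 0\<close> \<epsilon> by (simp add: p_def)
      also have "\<dots> < r"
        using mult_strict_left_mono[of "norm t" "r + \<epsilon>" r] t \<open>r > 0\<close> \<epsilon> by (simp add: divide_simps)
      finally have "p \<in> ball 0 r" by simp
      have "t - p = (1 - r / (r + \<epsilon>)) *\<^sub>R t" by (simp add: p_def scaleR_left_diff_distrib)
      also have "1 - r / (r + \<epsilon>) = \<epsilon> / (r + \<epsilon>)" using \<open>r > 0\<close> \<epsilon> by (simp add: field_simps)
      finally have "norm (t - p) = \<epsilon> / (r + \<epsilon>) * norm t" using \<open>r > 0\<close> \<epsilon> by simp
      also have "\<dots> < \<epsilon>"
        using mult_strict_left_mono[of "norm t" "r + \<epsilon>" \<epsilon>] t \<open>r > 0\<close> \<epsilon> by (simp add: divide_simps)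
      finally show ?thesis using \<open>p \<in> ball 0 r\<close> by (auto simp: dist_norm norm_minus_commute)
    qed
    then obtain p where p: "p \<in> ball 0 r" "t \<in> ball p \<epsilon>" by auto
    have "((\<lambda>s. u p s $ k) has_field_derivative F (Y t) $ k) (at t)"
      using u[OF p(1)] p Yu[OF p] by (auto simp: solves_def)
    then show ?thesis
      by (rule has_field_derivative_transform_within_open[of _ _ _ "ball p \<epsilon>"]) (use p Yu in auto)
  qed
  moreover have "Y 0 = y 0" using Yu[of 0 0] up[of 0] \<open>r > 0\<close> \<epsilon> by simp
  ultimately show ?thesis unfolding solves_def \<epsilon>_def by blast
qed

text \<open>
  The a priori hypothesis confines each solution to \<open>Z\<close> up to radius \<open>R\<close>. On \<open>Z\<close> the extension step
  has a fixed length, and so finitely many steps lead beyond \<open>R\<close>. The closed disk of radius \<open>R\<close>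
  then lies inside an open disk of existence.
\<close>
lemma solution_beyond_radius:
  fixes F :: "complex^'k \<Rightarrow> complex^'k" and d B :: real
  assumes F: "holo_field F W" and bd: "\<And>z. z \<in> Z \<Longrightarrow> bounded_on_ball F W d B z"
    and "d > 0" "B > 0" and "R > 0" and "z0 \<in> Z"
    and apriori: "\<And>r y. 0 < r \<Longrightarrow> r \<le> R \<Longrightarrow> solves F y (ball 0 r) \<Longrightarrow> y 0 = z0 \<Longrightarrow> y ` ball 0 r \<subseteq> Z"
  shows "\<exists>\<rho>>R. \<exists>y. solves F y (ball 0 \<rho>) \<and> y 0 = z0"
proof -
  define \<epsilon> where "\<epsilon> = d / (4 * real CARD('k) * B)"
  have \<epsilon>: "\<epsilon> > 0" using assms by (simp add: \<epsilon>_def)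
  have "\<exists>y. solves F y (ball 0 (min R (n * \<epsilon>) + \<epsilon>)) \<and> y 0 = z0" for n :: nat
  proof (induction n)
    case 0
    show ?case
      using local_existence[OF F bd[OF \<open>z0 \<in> Z\<close>] \<open>d > 0\<close> \<open>B > 0\<close>, of 0] \<open>R > 0\<close>
      by (simp add: \<epsilon>_def)
  next
    case (Suc n)
    then obtain y where y: "solves F y (ball 0 (min R (n * \<epsilon>) + \<epsilon>))" "y 0 = z0" by auto
    define r where "r = min R (Suc n * \<epsilon>)"
    have r: "0 < r" "r \<le> R" using \<open>R > 0\<close> \<epsilon> by (auto simp: r_def)
    have "r \<le> min R (n * \<epsilon>) + \<epsilon>" using \<epsilon> by (auto simp: r_def min_def algebra_simps)
    then have yr: "solves F y (ball 0 r)" using y(1) by (auto intro: solves_subset)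
    have "y ` ball 0 r \<subseteq> Z" by (rule apriori[OF r yr y(2)])
    from solution_extends[OF F bd \<open>d > 0\<close> \<open>B > 0\<close> r(1) yr this]
    show ?case using y(2) by (auto simp: \<epsilon>_def r_def)
  qed
  moreover obtain n :: nat where "R < n * \<epsilon>" using \<epsilon> reals_Archimedean3 by blast
  ultimately have "\<exists>y. solves F y (ball 0 (R + \<epsilon>)) \<and> y 0 = z0"
    by (metis min.absorb1 less_imp_le)
  then show ?thesis using \<epsilon> by (intro exI[of _ "R + \<epsilon>"]) auto
qed

section \<open>Force bounds near a real configuration\<close>

lemma norm_cvec: "norm (cvec x) = norm x"
  by (simp add: cvec_def norm_vec_def)

lemma cvec_diff: "cvec (x - y) = cvec x - cvec y"
  by (simp add: cvec_def vec_eq_iff)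

text \<open>
  The triangle inequality reduces the bilinear form to the real vectors of moduli, where
  Cauchy--Schwarz applies.
\<close>
lemma norm_bilinear_le:
  fixes a b :: "complex^'k"
  shows "norm (\<Sum>k\<in>UNIV. a $ k * b $ k) \<le> norm a * norm b"
proof -
  have "norm (\<Sum>k\<in>UNIV. a $ k * b $ k) \<le> (\<Sum>k\<in>UNIV. \<bar>norm (a $ k)\<bar> * \<bar>norm (b $ k)\<bar>)"
    by (intro order_trans[OF norm_sum]) (simp add: norm_mult)
  also have "\<dots> \<le> norm a * norm b"
    unfolding norm_vec_def by (rule L2_set_mult_ineq)
  finally show ?thesis .
qed

lemma bilin_sq_cvec: "bilin_sq (cvec x) = of_real ((norm x)\<^sup>2)"
  by (simp add: bilin_sq_def cvec_def norm_vec_def L2_set_def sum_nonneg)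

text \<open>
  With \<open>u = cvec x + w\<close> the deviation is \<open>2 * x\<^sup>T w + w\<^sup>T w\<close>.
\<close>
lemma bilin_sq_near_real:
  assumes "norm (u - cvec x) \<le> l * norm x"
  shows "norm (bilin_sq u - of_real ((norm x)\<^sup>2)) \<le> (2 * l + l\<^sup>2) * (norm x)\<^sup>2"
proof -
  define w where "w = u - cvec x"
  have "bilin_sq u - bilin_sq (cvec x) =
      2 * (\<Sum>k\<in>UNIV. cvec x $ k * w $ k) + (\<Sum>k\<in>UNIV. w $ k * w $ k)"
    unfolding bilin_sq_def sum_distrib_left sum.distrib[symmetric] sum_subtractf[symmetric] w_def
    by (intro sum.cong refl) (simp add: power2_eq_square algebra_simps)
  also have "norm \<dots> \<le> 2 * (norm x * norm w) + norm w * norm w"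
    using norm_bilinear_le[of "cvec x" w] norm_bilinear_le[of w w]
    by (intro norm_triangle_le) (simp add: norm_mult norm_cvec)
  also have "\<dots> \<le> 2 * (norm x * (l * norm x)) + (l * norm x) * (l * norm x)"
    using assms order_trans[OF norm_ge_zero assms]
    by (intro add_mono mult_left_mono mult_mono) (auto simp: w_def)
  finally show ?thesis by (simp add: bilin_sq_cvec power2_eq_square algebra_simps)
qed

text \<open>
  The bound \<open>sqrt 2 - 1\<close> is the positive root of \<open>1 - 2 * l - l\<^sup>2\<close>, the factor that bounds
  \<open>bilin_sq\<close> away from zero.
\<close>
lemma gap_pos:
  assumes "0 \<le> (l::real)" "l < sqrt 2 - 1"
  shows "1 - 2 * l - l\<^sup>2 > 0"
proof -
  have "(1 + l)\<^sup>2 < (sqrt 2)\<^sup>2" using assms by (intro power_strict_mono) auto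
  then show ?thesis by (simp add: power2_eq_square algebra_simps)
qed

lemma Re_bilin_sq_pos:
  assumes "norm (u - cvec x) \<le> l * norm x" and "x \<noteq> 0" "0 \<le> l" "l < sqrt 2 - 1"
  shows "Re (bilin_sq u) > 0" and "(1 - 2 * l - l\<^sup>2) * (norm x)\<^sup>2 \<le> norm (bilin_sq u)"
proof -
  have "(norm x)\<^sup>2 - Re (bilin_sq u) \<le> norm (bilin_sq u - of_real ((norm x)\<^sup>2))"
    using complex_Re_le_cmod[of "of_real ((norm x)\<^sup>2) - bilin_sq u"] by (simp add: norm_minus_commute)
  with bilin_sq_near_real[OF assms(1)]
  have *: "(1 - 2 * l - l\<^sup>2) * (norm x)\<^sup>2 \<le> Re (bilin_sq u)" by (simp add: algebra_simps)
  have "(1 - 2 * l - l\<^sup>2) * (norm x)\<^sup>2 > 0"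
    using gap_pos[OF assms(3,4)] \<open>x \<noteq> 0\<close> by simp
  with * show "Re (bilin_sq u) > 0" by linarith
  show "(1 - 2 * l - l\<^sup>2) * (norm x)\<^sup>2 \<le> norm (bilin_sq u)"
    using * complex_Re_le_cmod order_trans by blast
qed

text \<open>
  The numerator is at most \<open>(1 + l) * norm x\<close> and the denominator at least
  \<open>((1 - 2 * l - l\<^sup>2) * (norm x)\<^sup>2) powr (3 / 2)\<close>; their quotient is the origin of \<open>eta\<close>.
\<close>
lemma norm_attraction_le:
  fixes u :: "complex^'k"
  assumes u: "norm (u - cvec x) \<le> l * norm x" and x: "x \<noteq> 0" and l: "0 \<le> l" "l < sqrt 2 - 1" and "a \<ge> 0"
  shows "norm ((complex_of_real a / bilin_sq u powr (3 / 2)) *s (- u)) \<le> eta l * (a / (norm x)\<^sup>2)"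
proof -
  define g where "g = 1 - 2 * l - l\<^sup>2"
  have g: "g > 0" using gap_pos[OF l] by (simp add: g_def)
  have eta_eq: "eta l = (1 + l) / g powr (3 / 2)" by (simp add: eta_def g_def)
  have nx: "norm x > 0" using x by simp
  have "norm (u - cvec x + cvec x) \<le> l * norm x + norm x"
    using u norm_triangle_ineq[of "u - cvec x" "cvec x"] by (simp add: norm_cvec)
  then have nu: "norm u \<le> (1 + l) * norm x" by (simp add: algebra_simps)
  have "(g * (norm x)\<^sup>2) powr (3 / 2) \<le> norm (bilin_sq u) powr (3 / 2)"
    using Re_bilin_sq_pos(2)[OF u x l] g by (intro powr_mono2) (auto simp: g_def)
  also have "\<dots> = norm (bilin_sq u powr (3 / 2))"
    by (subst norm_powr_real_powr') auto
  finally have den: "(g * (norm x)\<^sup>2) powr (3 / 2) \<le> norm (bilin_sq u powr (3 / 2))" .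
  have "((norm x)\<^sup>2) powr (3 / 2) = norm x ^ 3"
    using nx by (simp add: powr_powr flip: powr_numeral)
  then have pw: "(g * (norm x)\<^sup>2) powr (3 / 2) = g powr (3 / 2) * norm x ^ 3"
    using g by (simp add: powr_mult)
  have "norm ((complex_of_real a / bilin_sq u powr (3 / 2)) *s (- u))
      = a / norm (bilin_sq u powr (3 / 2)) * norm u"
    using \<open>a \<ge> 0\<close> by (simp add: norm_vector_smult norm_divide)
  also have "\<dots> \<le> a / (g powr (3 / 2) * norm x ^ 3) * ((1 + l) * norm x)"
  proof -
    have pos: "0 < g powr (3 / 2) * norm x ^ 3" using g nx by simp
    then have "a / norm (bilin_sq u powr (3 / 2)) \<le> a / (g powr (3 / 2) * norm x ^ 3)"
      using den[unfolded pw] \<open>a \<ge> 0\<close> by (intro divide_left_mono mult_pos_pos[of "norm _"]) linarith+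
    then show ?thesis
      by (rule mult_mono[OF _ nu]) (use pos \<open>a \<ge> 0\<close> in \<open>auto intro: divide_nonneg_pos\<close>)
  qed
  also have "\<dots> = eta l * (a / (norm x)\<^sup>2)"
    using g nx by (simp add: eta_eq field_simps power2_eq_square power3_eq_cube)
  finally show ?thesis .
qed

lemma eta_pos: "0 \<le> l \<Longrightarrow> l < sqrt 2 - 1 \<Longrightarrow> eta l > 0"
  using gap_pos[of l] by (simp add: eta_def)

text \<open>
  The neighbourhood constrains only the pairs \<open>i < j\<close>, while the forces run over all \<open>j \<noteq> i\<close>.
\<close>
lemma complex_nbhd_pair:
  assumes "q \<in> complex_nbhd l q0" "i \<noteq> j"
  shows "norm ((q $ i - q $ j) - cvec (q0 $ i - q0 $ j)) \<le> l * norm (q0 $ i - q0 $ j)"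
proof -
  have *: "norm ((q $ i - q $ j) - cvec (q0 $ i - q0 $ j)) \<le> l * norm (q0 $ i - q0 $ j)" if "i < j" for i j
    using assms(1) that by (auto simp: complex_nbhd_def cvec_diff algebra_simps)
  show ?thesis
  proof (cases "i < j")
    case False
    then have "j < i" using \<open>i \<noteq> j\<close> by auto
    have "(q $ i - q $ j) - cvec (q0 $ i - q0 $ j) = - ((q $ j - q $ i) - cvec (q0 $ j - q0 $ i))"
      by (simp add: cvec_diff)
    then show ?thesis
      using *[OF \<open>j < i\<close>] by (simp only: norm_minus_cancel norm_minus_commute[of "q0 $ i"])
  qed (rule *)
qed

lemma distinct_positions: "q0 \<notin> collision_set \<Longrightarrow> i \<noteq> j \<Longrightarrow> q0 $ i - q0 $ j \<noteq> 0"
  by (auto simp: collision_set_def)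

lemma norm_grav_acc_le:
  fixes m :: "real^'n::{finite,linorder}"
  assumes q: "q \<in> complex_nbhd l q0" and l: "0 \<le> l" "l < sqrt 2 - 1"
    and "q0 \<notin> collision_set" "G > 0" "\<And>i. m $ i > 0"
  shows "norm (grav_acc G m q i) \<le> eta l * K_fun G m q0 i"
  unfolding grav_acc_def K_fun_def sum_distrib_left
proof (rule sum_norm_le)
  fix j assume "j \<in> UNIV - {i}"
  then have ij: "i \<noteq> j" by auto
  have "q0 $ i - q0 $ j \<noteq> 0" using \<open>q0 \<notin> collision_set\<close> ij by (rule distinct_positions)
  from norm_attraction_le[OF complex_nbhd_pair[OF q ij] this l, of "G * m $ j"]
  show "norm ((complex_of_real (G * m $ j) / bilin_sq (q $ i - q $ j) powr (3 / 2)) *s (q $ j - q $ i))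
      \<le> eta l * (G * m $ j / (norm (q0 $ i - q0 $ j))\<^sup>2)"
    using assms(5) assms(6)[of j] by (simp add: less_imp_le)
qed

section \<open>The first-order system\<close>

text \<open>
  Positions and velocities form one vector, so that the second-order system becomes
  an equation of the form \<open>y' = F y\<close> for curves in \<open>complex^'k\<close>.
\<close>
definition pos_part :: "complex^(('n \<times> 3) + ('n \<times> 3)) \<Rightarrow> complex^3^'n" where
  "pos_part y = (\<chi> i k. y $ Inl (i, k))"

definition vel_part :: "complex^(('n \<times> 3) + ('n \<times> 3)) \<Rightarrow> complex^3^'n" where
  "vel_part y = (\<chi> i k. y $ Inr (i, k))"

definition join_state :: "complex^3^'n \<Rightarrow> complex^3^'n \<Rightarrow> complex^(('n \<times> 3) + ('n \<times> 3))" where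
  "join_state q v = (\<chi> a. case a of Inl (i, k) \<Rightarrow> q $ i $ k | Inr (i, k) \<Rightarrow> v $ i $ k)"

definition nbody_field ::
  "real \<Rightarrow> real^'n \<Rightarrow> complex^(('n::finite \<times> 3) + ('n \<times> 3)) \<Rightarrow> complex^(('n \<times> 3) + ('n \<times> 3))" where
  "nbody_field G m y = join_state (vel_part y) (\<chi> i. grav_acc G m (pos_part y) i)"

lemma join_state_nth [simp]:
  "join_state q v $ Inl (i, k) = q $ i $ k" "join_state q v $ Inr (i, k) = v $ i $ k"
  by (simp_all add: join_state_def)

lemma pos_part_nth [simp]: "pos_part y $ i $ k = y $ Inl (i, k)"
  by (simp add: pos_part_def)

lemma vel_part_nth [simp]: "vel_part y $ i $ k = y $ Inr (i, k)"
  by (simp add: vel_part_def)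

lemma parts_join [simp]: "pos_part (join_state q v) = q" "vel_part (join_state q v) = v"
  by (simp_all add: vec_eq_iff)

lemma nbody_field_nth [simp]:
  "nbody_field G m y $ Inl (i, k) = y $ Inr (i, k)"
  "nbody_field G m y $ Inr (i, k) = grav_acc G m (pos_part y) i $ k"
  by (simp_all add: nbody_field_def)

lemma all_state_index: "(\<forall>a::('n \<times> 3) + ('n \<times> 3). P a) \<longleftrightarrow> (\<forall>i k. P (Inl (i, k)) \<and> P (Inr (i, k)))"
  by (metis sum.exhaust surj_pair)

lemma solves_nbody_iff:
  "solves (nbody_field G m) y S \<longleftrightarrow>
     (\<forall>t\<in>S. \<forall>i k. ((\<lambda>s. y s $ Inl (i, k)) has_field_derivative y t $ Inr (i, k)) (at t) \<and>
        ((\<lambda>s. y s $ Inr (i, k)) has_field_derivative grav_acc G m (pos_part (y t)) i $ k) (at t))"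
  unfolding solves_def all_state_index nbody_field_nth ..

text \<open>
  On the neighbourhood the expressions \<open>bilin_sq (q $ i - q $ j)\<close> have positive real part and
  so avoid the branch cut of the logarithm, through which the power is a holomorphic function.
\<close>
lemma holo_field_nbody:
  fixes q0 :: "real^3^'n::{finite,linorder}"
  assumes l: "0 \<le> l" "l < sqrt 2 - 1" and "q0 \<notin> collision_set"
  shows "holo_field (nbody_field G m) {y. pos_part y \<in> complex_nbhd l q0}"
  unfolding holo_field_def
proof (intro allI impI)
  fix \<gamma> :: "complex \<Rightarrow> complex^(('n \<times> 3) + ('n \<times> 3))" and U
  assume U: "open U" and hol: "holo_curve \<gamma> U" and sub: "\<gamma> ` U \<subseteq> {y. pos_part y \<in> complex_nbhd l q0}"
  have hol': "(\<lambda>t. \<gamma> t $ a) holomorphic_on U" for a using hol by (simp add: holo_curve_def)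
  have "(\<lambda>t. grav_acc G m (pos_part (\<gamma> t)) i $ k) holomorphic_on U" for i k
  proof -
    define u where "u j t = bilin_sq (pos_part (\<gamma> t) $ i - pos_part (\<gamma> t) $ j)" for j t
    have holu: "u j holomorphic_on U" for j
      unfolding u_def bilin_sq_def vector_minus_component pos_part_nth
      by (intro holomorphic_intros hol')
    have u: "u j t \<notin> \<real>\<^sub>\<le>\<^sub>0" if "t \<in> U" "j \<noteq> i" for j t
    proof -
      have q: "pos_part (\<gamma> t) \<in> complex_nbhd l q0" using sub that by auto
      have "q0 $ i - q0 $ j \<noteq> 0"
        using \<open>q0 \<notin> collision_set\<close> that(2)[symmetric] by (rule distinct_positions)
      then have "Re (u j t) > 0"
        unfolding u_def
        by (rule Re_bilin_sq_pos(1)[OF complex_nbhd_pair[OF q that(2)[symmetric]] _ l])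
      then show ?thesis by (auto simp: complex_nonpos_Reals_iff)
    qed
    have "(\<lambda>t. \<Sum>j\<in>UNIV - {i}. complex_of_real (G * m $ j) / exp (3 / 2 * Ln (u j t)) *
            (\<gamma> t $ Inl (j, k) - \<gamma> t $ Inl (i, k))) holomorphic_on U"
      by (intro holomorphic_intros hol' holomorphic_on_Ln' holu u) auto
    moreover have "(\<Sum>j\<in>UNIV - {i}. complex_of_real (G * m $ j) / exp (3 / 2 * Ln (u j t)) *
            (\<gamma> t $ Inl (j, k) - \<gamma> t $ Inl (i, k))) = grav_acc G m (pos_part (\<gamma> t)) i $ k" if "t \<in> U" for t
      unfolding grav_acc_def sum_component
    proof (rule sum.cong[OF refl])
      fix j assume j: "j \<in> UNIV - {i}"
      then have "u j t \<noteq> 0" using u[OF that, of j] by auto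
      then show "complex_of_real (G * m $ j) / exp (3 / 2 * Ln (u j t)) * (\<gamma> t $ Inl (j, k) - \<gamma> t $ Inl (i, k)) =
        ((complex_of_real (G * m $ j) / bilin_sq (pos_part (\<gamma> t) $ i - pos_part (\<gamma> t) $ j) powr (3 / 2)) *s
          (pos_part (\<gamma> t) $ j - pos_part (\<gamma> t) $ i)) $ k"
        by (simp only: powr_def u_def vector_smult_component vector_minus_component pos_part_nth if_False)
    qed
    ultimately show ?thesis by (simp cong: holomorphic_cong)
  qed
  then show "holo_curve (\<lambda>t. nbody_field G m (\<gamma> t)) U"
    using hol' unfolding holo_curve_def all_state_index nbody_field_nth by blast
qed

section \<open>Calculus along rays\<close>

lemma has_vector_derivative_vec:
  fixes f :: "real \<Rightarrow> complex^'k"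
  assumes "\<And>k. ((\<lambda>x. f x $ k) has_vector_derivative f' $ k) (at x)"
  shows "(f has_vector_derivative f') (at x)"
proof -
  have "((\<lambda>y. ((f y - f x) - (y - x) *\<^sub>R f') /\<^sub>R norm (y - x)) \<longlongrightarrow> 0) (at x)"
  proof (rule vec_tendstoI)
    fix k
    have "((\<lambda>y. ((f y $ k - f x $ k) - (y - x) *\<^sub>R f' $ k) /\<^sub>R norm (y - x)) \<longlongrightarrow> 0) (at x)"
      using assms[of k] by (simp add: has_vector_derivative_def has_derivative_def)
    then show "((\<lambda>y. (((f y - f x) - (y - x) *\<^sub>R f') /\<^sub>R norm (y - x)) $ k) \<longlongrightarrow> 0 $ k) (at x)"
      by simp
  qed
  then show ?thesis
    by (simp add: has_vector_derivative_def has_derivative_def bounded_linear_scaleR_left)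
qed

text \<open>
  Restricting to the segment from \<open>0\<close> to \<open>t\<close> reduces estimates in complex time to real mean value
  inequalities for vector-valued functions.
\<close>
lemma has_vector_derivative_ray:
  fixes f :: "complex \<Rightarrow> complex^'k"
  assumes "\<And>k. ((\<lambda>s. f s $ k) has_field_derivative f' $ k) (at (of_real x * t))"
  shows "((\<lambda>x. f (of_real x * t)) has_vector_derivative t *s f') (at x)"
proof (rule has_vector_derivative_vec)
  fix k
  have "((\<lambda>z. z * t) has_field_derivative t) (at (of_real x))"
    by (auto intro!: derivative_eq_intros)
  from DERIV_chain2[OF assms this]
  show "((\<lambda>x. f (of_real x * t) $ k) has_vector_derivative (t *s f') $ k) (at x)"
    by (intro has_vector_derivative_real_field) (simp add: mult.commute)
qed

text \<open>
  A first-exit argument. At the first time outside the open set \<open>N'\<close> the path has been in the closed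
  set \<open>N\<close> up to and including that time, and then \<open>step\<close> puts it into \<open>N'\<close>.
\<close>
lemma stays_in_closed_set:
  fixes h :: "real \<Rightarrow> 'a::topological_space"
  assumes cont: "continuous_on {0..1} h" and "closed N" "open N'" "N' \<subseteq> N" and h0: "h 0 \<in> N"
    and step: "\<And>x. x \<in> {0..1} \<Longrightarrow> h ` {0..x} \<subseteq> N \<Longrightarrow> h x \<in> N'"
  shows "h ` {0..1} \<subseteq> N"
proof -
  define S where "S = {0..1} \<inter> h -` (- N')"
  have "S = {}"
  proof (rule ccontr)
    assume "S \<noteq> {}"
    have "closed S"
      unfolding S_def by (rule continuous_closed_preimage[OF cont]) (use \<open>open N'\<close> in auto)
    moreover have "bounded S" unfolding S_def by (rule bounded_subset[OF bounded_closed_interval[of 0 1]]) auto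
    ultimately have "compact S" by (simp add: compact_eq_bounded_closed)
    then obtain x0 where x0: "x0 \<in> S" "\<And>x. x \<in> S \<Longrightarrow> x0 \<le> x"
      using compact_attains_inf[OF _ \<open>S \<noteq> {}\<close>] by blast
    have x01: "x0 \<in> {0..1}" "h x0 \<notin> N'" using x0(1) by (auto simp: S_def)
    have before: "h x \<in> N" if "x \<in> {0..<x0}" for x
    proof -
      have "x \<in> {0..1}" "x \<notin> S" using that x01 x0(2)[of x] by auto
      then show ?thesis using \<open>N' \<subseteq> N\<close> by (auto simp: S_def)
    qed
    have "h ` {0..x0} \<subseteq> N"
    proof (cases "x0 = 0")
      case False
      then have cl: "closure {0..<x0} = {0..x0}" using x01 by simp
      have "h ` closure {0..<x0} \<subseteq> N"
        by (rule image_closure_subset[OF _ \<open>closed N\<close>])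
           (use before continuous_on_subset[OF cont, of "{0..x0}"] x01 cl in auto)
      then show ?thesis unfolding cl .
    qed (use h0 in auto)
    with step x01 show False by blast
  qed
  then show ?thesis using \<open>N' \<subseteq> N\<close> by (auto simp: S_def)
qed

section \<open>A priori estimates for the \<open>N\<close>-body problem\<close>

lemma K_fun_pos:
  fixes m :: "real^'n::finite"
  assumes "CARD('n) \<ge> 2" "q0 \<notin> collision_set" "G > 0" "\<And>i. m $ i > 0"
  shows "K_fun G m q0 i > 0"
proof -
  have "UNIV - {i} \<noteq> {}"
    using assms(1) card_mono[of "{i}" "UNIV :: 'n set"] by (intro notI) auto
  then show ?thesis
    unfolding K_fun_def using assms distinct_positions[OF assms(2), of i]
    by (intro sum_pos) auto
qed

text \<open>
  \<open>L\<close> is the positive root of \<open>p * L\<^sup>2 - a * L - b / 2\<close>. Its inverse \<open>X\<close> therefore satisfies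
  \<open>X * a + X\<^sup>2 / 2 * b = p\<close>, and the left-hand side increases strictly in \<open>X \<ge> 0\<close>. This explains the
  formula for the quantities \<open>L_pair\<close>.
\<close>
lemma quadratic_bound_of_radius:
  fixes a b p x L :: real
  assumes "a \<ge> 0" "b > 0" "p > 0"
    and L: "L = a / (2 * p) + sqrt ((a / (2 * p))\<^sup>2 + b / (2 * p))" and x: "0 \<le> x"
  shows "L > 0" and "x \<le> inverse L \<Longrightarrow> x * a + x\<^sup>2 / 2 * b \<le> p"
    and "x < inverse L \<Longrightarrow> x * a + x\<^sup>2 / 2 * b < p"
proof -
  define A B where "A = a / (2 * p)" and "B = b / (2 * p)"
  have A: "A \<ge> 0" and B: "B > 0" using assms by (auto simp: A_def B_def)
  have "sqrt (A\<^sup>2 + B) > 0" using B by (simp add: add_nonneg_pos)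
  then show Lpos: "L > 0" using A unfolding L A_def[symmetric] B_def[symmetric] by linarith
  have "(L - A)\<^sup>2 = A\<^sup>2 + B" using B unfolding L A_def[symmetric] B_def[symmetric] by simp
  then have L2: "L\<^sup>2 = 2 * A * L + B" by (simp add: power2_eq_square algebra_simps)
  define X where "X = inverse L"
  have "X * a + X\<^sup>2 / 2 * b = p * (X\<^sup>2 * (2 * A * L + B))"
    using \<open>p > 0\<close> Lpos by (simp add: A_def B_def X_def field_simps power2_eq_square)
  also have "\<dots> = p" unfolding L2[symmetric] using Lpos by (simp add: X_def power2_eq_square field_simps)
  finally have X: "X * a + X\<^sup>2 / 2 * b = p" .
  show "x * a + x\<^sup>2 / 2 * b \<le> p" if "x \<le> inverse L"
  proof -
    have "x * a + x\<^sup>2 / 2 * b \<le> X * a + X\<^sup>2 / 2 * b"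
      using that x assms by (intro add_mono mult_right_mono divide_right_mono power_mono) (auto simp: X_def)
    with X show ?thesis by simp
  qed
  show "x * a + x\<^sup>2 / 2 * b < p" if "x < inverse L"
  proof -
    have "x\<^sup>2 < X\<^sup>2" using that x by (intro power_strict_mono) (auto simp: X_def)
    then have "x * a + x\<^sup>2 / 2 * b < X * a + X\<^sup>2 / 2 * b"
      using that x assms by (intro add_le_less_mono mult_right_mono mult_strict_right_mono) (auto simp: X_def)
    with X show ?thesis by simp
  qed
qed

lemma exists_ordered_pair:
  assumes "CARD('n::{finite,linorder}) \<ge> 2"
  shows "\<exists>i j :: 'n. i < j"
proof -
  obtain i j :: 'n where "i \<noteq> j"
    using assms card_le_Suc0_iff_eq[of "UNIV :: 'n set"] by fastforce
  then show ?thesis using linorder_neq_iff by blast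
qed

lemma closed_complex_nbhd: "closed (complex_nbhd l q0)"
  unfolding complex_nbhd_def
  by (intro closed_Collect_all closed_Collect_imp closed_Collect_le continuous_intros) auto

lemma initial_in_nbhd: "0 \<le> l \<Longrightarrow> (\<chi> i. cvec (q0 $ i)) \<in> complex_nbhd l q0"
  by (simp add: complex_nbhd_def)

lemma continuous_pos_part:
  "holo_curve y S \<Longrightarrow> continuous_on S (\<lambda>t. pos_part (y t))"
  by (intro continuous_on_vec_components) (simp add: holo_curve_def holomorphic_on_imp_continuous_on)

definition initial_state :: "real^3^'n \<Rightarrow> real^3^'n \<Rightarrow> complex^(('n \<times> 3) + ('n \<times> 3))" where
  "initial_state q0 v0 = join_state (\<chi> i. cvec (q0 $ i)) (\<chi> i. cvec (v0 $ i))"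

context
  fixes G :: real and m :: "real^'n::{finite,linorder}" and q0 v0 :: "real^3^'n::{finite,linorder}"
  assumes card: "CARD('n) \<ge> 2" and G: "G > 0" and m: "\<And>i. m $ i > 0"
    and q0: "q0 \<notin> collision_set"
begin

lemma M_fun_pos: "0 < l \<Longrightarrow> l < sqrt 2 - 1 \<Longrightarrow> M_fun G m q0 l i j > 0"
  using eta_pos[of l] K_fun_pos[OF card q0 G m] by (auto simp: M_fun_def add_pos_pos)

text \<open>
  At the times of the disk the asserted bound on the change of \<open>q $ i - q $ j\<close> does not exceed the
  size \<open>l * norm (q0 $ i - q0 $ j)\<close> of the neighbourhood. The strict version in the interior of the
  disk drives the first-exit argument.
\<close>
lemma time_bounds:
  assumes l: "0 < l" "l < sqrt 2 - 1" and "i < j"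
  shows "L_max G m q0 v0 l > 0"
    and "0 \<le> x \<Longrightarrow> x \<le> inverse (L_max G m q0 v0 l) \<Longrightarrow>
      x * norm (v0 $ i - v0 $ j) + x\<^sup>2 / 2 * M_fun G m q0 l i j \<le> l * norm (q0 $ i - q0 $ j)"
    and "0 \<le> x \<Longrightarrow> x < inverse (L_max G m q0 v0 l) \<Longrightarrow>
      x * norm (v0 $ i - v0 $ j) + x\<^sup>2 / 2 * M_fun G m q0 l i j < l * norm (q0 $ i - q0 $ j)"
proof -
  have p: "l * norm (q0 $ i - q0 $ j) > 0"
    using l distinct_positions[OF q0, of i j] \<open>i < j\<close> by auto
  define L where "L = L_pair G m q0 v0 l i j"
  have L: "L = norm (v0 $ i - v0 $ j) / (2 * (l * norm (q0 $ i - q0 $ j))) +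
     sqrt ((norm (v0 $ i - v0 $ j) / (2 * (l * norm (q0 $ i - q0 $ j))))\<^sup>2 +
           M_fun G m q0 l i j / (2 * (l * norm (q0 $ i - q0 $ j))))"
    by (simp add: L_def L_pair_def mult.assoc)
  note Q = quadratic_bound_of_radius[OF norm_ge_zero M_fun_pos[OF l] p L]
  have Lpos: "L > 0" using Q(1)[of 0] by simp
  have "finite {L_pair G m q0 v0 l i j | i j. i < j}"
    by (rule finite_subset[of _ "(\<lambda>(i, j). L_pair G m q0 v0 l i j) ` UNIV"]) auto
  then have LL: "L \<le> L_max G m q0 v0 l"
    unfolding L_max_def L_def using \<open>i < j\<close> by (intro Max_ge) auto
  with Lpos show Lm: "L_max G m q0 v0 l > 0" by linarith
  have inv: "inverse (L_max G m q0 v0 l) \<le> inverse L"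
    using LL Lpos by (rule le_imp_inverse_le)
  show "x * norm (v0 $ i - v0 $ j) + x\<^sup>2 / 2 * M_fun G m q0 l i j \<le> l * norm (q0 $ i - q0 $ j)"
    if "0 \<le> x" "x \<le> inverse (L_max G m q0 v0 l)"
    using Q(2)[of x] inv that by linarith
  show "x * norm (v0 $ i - v0 $ j) + x\<^sup>2 / 2 * M_fun G m q0 l i j < l * norm (q0 $ i - q0 $ j)"
    if "0 \<le> x" "x < inverse (L_max G m q0 v0 l)"
    using Q(3)[of x] inv that by linarith
qed

text \<open>
  Integration of the force bound along the ray from \<open>0\<close> to \<open>t\<close>.
\<close>
lemma velocity_deviation_le:
  assumes l: "0 \<le> l" "l < sqrt 2 - 1" and y: "solves (nbody_field G m) y (ball 0 r)" and t: "t \<in> ball 0 r"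
    and near: "\<And>x. x \<in> {0..1} \<Longrightarrow> pos_part (y (of_real x * t)) \<in> complex_nbhd l q0"
  shows "norm (vel_part (y t) $ i - vel_part (y 0) $ i) \<le> norm t * (eta l * K_fun G m q0 i)"
proof -
  define f where "f s = vel_part (y s) $ i" for s
  have inb: "of_real x * t \<in> ball 0 r" if "x \<in> {0..1}" for x :: real
    using that t mult_left_le_one_le[of "norm t" x] by (auto simp: norm_mult)
  have der: "((\<lambda>x. f (of_real x * t)) has_vector_derivative t *s grav_acc G m (pos_part (y (of_real x * t))) i) (at x)"
    if "x \<in> {0..1}" for x
    by (rule has_vector_derivative_ray) (use y inb[OF that] in \<open>auto simp: f_def solves_nbody_iff\<close>)
  have "norm (f (of_real 1 * t) - f (of_real 0 * t)) \<le> 1 * (norm t * (eta l * K_fun G m q0 i)) - 0 * (norm t * (eta l * K_fun G m q0 i))"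
  proof (rule differentiable_bound_general[where \<phi> = "\<lambda>x. x * (norm t * (eta l * K_fun G m q0 i))"
        and f = "\<lambda>x. f (of_real x * t)" and f' = "\<lambda>x. t *s grav_acc G m (pos_part (y (of_real x * t))) i"
        and \<phi>' = "\<lambda>x. norm t * (eta l * K_fun G m q0 i)"])
    show "continuous_on {0..1} (\<lambda>x. f (of_real x * t))"
      using der has_vector_derivative_continuous continuous_at_imp_continuous_on by blast
    fix x :: real assume x: "0 < x" "x < 1"
    show "((\<lambda>x. x * (norm t * (eta l * K_fun G m q0 i))) has_vector_derivative norm t * (eta l * K_fun G m q0 i)) (at x)"
      by (auto intro!: derivative_eq_intros simp flip: has_real_derivative_iff_has_vector_derivative)
    show "norm (t *s grav_acc G m (pos_part (y (of_real x * t))) i) \<le> norm t * (eta l * K_fun G m q0 i)"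
      unfolding norm_vector_smult
      by (intro mult_left_mono norm_grav_acc_le[OF near l q0 G m]) (use x in auto)
  qed (use der in \<open>auto intro!: continuous_intros\<close>)
  then show ?thesis by (simp add: f_def)
qed

text \<open>
  The velocity estimate for a pair is the sum of those for its bodies. Since it holds at every point
  of the ray, integrating it once more gives the estimate for the positions.
\<close>
lemma pair_deviation_le:
  assumes l: "0 \<le> l" "l < sqrt 2 - 1" and y: "solves (nbody_field G m) y (ball 0 r)" and t: "t \<in> ball 0 r"
    and near: "\<And>x. x \<in> {0..1} \<Longrightarrow> pos_part (y (of_real x * t)) \<in> complex_nbhd l q0"
  shows "norm (vel_part (y t) $ i - vel_part (y t) $ j - vel_part (y 0) $ i + vel_part (y 0) $ j)
      \<le> M_fun G m q0 l i j * norm t" (is ?vel)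
    and "norm (pos_part (y t) $ i - pos_part (y t) $ j - pos_part (y 0) $ i + pos_part (y 0) $ j)
      \<le> norm t * norm (vel_part (y 0) $ i - vel_part (y 0) $ j) + (norm t)\<^sup>2 / 2 * M_fun G m q0 l i j" (is ?pos)
proof -
  define M where "M = M_fun G m q0 l i j"
  define V where "V s = vel_part (y s) $ i - vel_part (y s) $ j" for s
  define Q where "Q s = pos_part (y s) $ i - pos_part (y s) $ j" for s
  have inb: "of_real x * t \<in> ball 0 r" if "x \<in> {0..1}" for x :: real
    using that t mult_left_le_one_le[of "norm t" x] by (auto simp: norm_mult)
  have vel: "norm (V (of_real x * t) - V 0) \<le> x * norm t * M" if x: "x \<in> {0..1}" for x
  proof -
    have near': "pos_part (y (of_real x' * (of_real x * t))) \<in> complex_nbhd l q0" if "x' \<in> {0..1}" for x' :: real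
      using near[of "x' * x"] x that mult_le_one[of x' x] by (simp add: mult.assoc)
    note v = velocity_deviation_le[OF l y inb[OF x] near']
    have "norm (V (of_real x * t) - V 0) \<le>
        norm (of_real x * t) * (eta l * K_fun G m q0 i) + norm (of_real x * t) * (eta l * K_fun G m q0 j)"
      using norm_triangle_le_diff[OF add_mono[OF v[of i] v[of j]]] by (simp add: V_def algebra_simps)
    also have "\<dots> = x * norm t * M"
      using x by (simp add: norm_mult M_def M_fun_def algebra_simps)
    finally show ?thesis .
  qed
  from vel[of 1] show ?vel by (simp add: V_def M_def algebra_simps)
  define \<phi> where "\<phi> x = x * (norm t * norm (V 0)) + x\<^sup>2 * ((norm t)\<^sup>2 / 2 * M)" for x :: real
  have der: "((\<lambda>x. Q (of_real x * t)) has_vector_derivative t *s V (of_real x * t)) (at x)"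
    if "x \<in> {0..1}" for x
    by (rule has_vector_derivative_ray)
       (use y inb[OF that] in \<open>auto simp: Q_def V_def solves_nbody_iff intro!: DERIV_diff\<close>)
  have "norm (Q (of_real 1 * t) - Q (of_real 0 * t)) \<le> \<phi> 1 - \<phi> 0"
  proof (rule differentiable_bound_general[where \<phi> = \<phi>
        and f = "\<lambda>x. Q (of_real x * t)" and f' = "\<lambda>x. t *s V (of_real x * t)"
        and \<phi>' = "\<lambda>x. norm t * norm (V 0) + x * ((norm t)\<^sup>2 * M)"])
    show "continuous_on {0..1} (\<lambda>x. Q (of_real x * t))"
      using der has_vector_derivative_continuous continuous_at_imp_continuous_on by blast
    show "continuous_on {0..1} \<phi>" unfolding \<phi>_def by (intro continuous_intros)
    fix x :: real assume x: "0 < x" "x < 1"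
    show "(\<phi> has_vector_derivative norm t * norm (V 0) + x * ((norm t)\<^sup>2 * M)) (at x)"
      unfolding \<phi>_def has_real_derivative_iff_has_vector_derivative[symmetric]
      by (auto intro!: derivative_eq_intros)
    have "norm (V (of_real x * t)) \<le> norm (V 0) + x * norm t * M"
      using vel[of x] x norm_triangle_ineq2[of "V (of_real x * t)" "V 0"] by auto
    then have "norm t * norm (V (of_real x * t)) \<le> norm t * (norm (V 0) + x * norm t * M)"
      by (rule mult_left_mono) simp
    then show "norm (t *s V (of_real x * t)) \<le> norm t * norm (V 0) + x * ((norm t)\<^sup>2 * M)"
      by (simp add: norm_vector_smult power2_eq_square algebra_simps)
  qed (use der in auto)
  then show ?pos by (simp add: Q_def V_def M_def \<phi>_def algebra_simps)
qed

text \<open>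
  While a solution is in the neighbourhood, the estimates hold, and before the critical time they
  place it strictly inside. Hence it cannot reach the boundary first.
\<close>
lemma solution_stays_near:
  assumes l: "0 < l" "l < sqrt 2 - 1" and y: "solves (nbody_field G m) y (ball 0 r)" "y 0 = initial_state q0 v0"
    and r: "r \<le> inverse (L_max G m q0 v0 l)" and t: "t \<in> ball 0 r"
  shows "pos_part (y t) \<in> complex_nbhd l q0"
proof -
  define h where "h x = pos_part (y (of_real x * t))" for x :: real
  define N' where "N' = {q. \<forall>i j. i < j \<longrightarrow>
        norm (q $ i - q $ j - cvec (q0 $ i) + cvec (q0 $ j)) < l * norm (q0 $ i - q0 $ j)}"
  have inb: "of_real x * t \<in> ball 0 r" if "x \<in> {0..1}" for x :: real
    using that t mult_left_le_one_le[of "norm t" x] by (auto simp: norm_mult)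
  have "h ` {0..1} \<subseteq> complex_nbhd l q0"
  proof (rule stays_in_closed_set)
    show "continuous_on {0..1} h"
      unfolding h_def
      by (rule continuous_on_compose2[OF continuous_pos_part[OF solves_holo_curve[OF y(1)]]])
         (use inb in \<open>auto intro!: continuous_intros\<close>)
    show "closed (complex_nbhd l q0)" by (rule closed_complex_nbhd)
    have "N' = (\<Inter>i. \<Inter>j. {q. i < j \<longrightarrow>
        norm (q $ i - q $ j - cvec (q0 $ i) + cvec (q0 $ j)) < l * norm (q0 $ i - q0 $ j)})"
      by (auto simp: N'_def)
    also have "open \<dots>"
      by (intro open_INT ballI finite open_Collect_imp open_Collect_less continuous_intros) auto
    finally show "open N'" .
    show "N' \<subseteq> complex_nbhd l q0" by (auto simp: N'_def complex_nbhd_def less_imp_le)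
    show "h 0 \<in> complex_nbhd l q0" using y(2) initial_in_nbhd[OF less_imp_le[OF l(1)]] by (simp add: h_def initial_state_def)
  next
    fix x :: real assume x: "x \<in> {0..1}" and sub: "h ` {0..x} \<subseteq> complex_nbhd l q0"
    have near: "pos_part (y (of_real x' * (of_real x * t))) \<in> complex_nbhd l q0" if "x' \<in> {0..1}" for x' :: real
    proof -
      have "x' * x \<in> {0..x}" using that x mult_left_le_one_le[of x x'] by auto
      then have "h (x' * x) \<in> complex_nbhd l q0" using sub by blast
      then show ?thesis by (simp add: h_def mult.assoc)
    qed
    show "h x \<in> N'"
      unfolding N'_def
    proof (intro CollectI allI impI)
      fix i j :: 'n assume "i < j"
      have "norm (pos_part (y (of_real x * t)) $ i - pos_part (y (of_real x * t)) $ j - pos_part (y 0) $ i + pos_part (y 0) $ j)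
        \<le> norm (of_real x * t) * norm (vel_part (y 0) $ i - vel_part (y 0) $ j)
          + (norm (of_real x * t))\<^sup>2 / 2 * M_fun G m q0 l i j"
        by (rule pair_deviation_le(2)[OF _ l(2) y(1) inb[OF x] near]) (use l in auto)
      also have "\<dots> < l * norm (q0 $ i - q0 $ j)"
        using time_bounds(3)[OF l \<open>i < j\<close>, of "norm (of_real x * t)"] inb[OF x] r y(2)
        by (simp add: initial_state_def norm_cvec flip: cvec_diff)
      finally show "norm (h x $ i - h x $ j - cvec (q0 $ i) + cvec (q0 $ j)) < l * norm (q0 $ i - q0 $ j)"
        using y(2) by (simp add: h_def initial_state_def)
    qed
  qed
  then have "h 1 \<in> complex_nbhd l q0" by auto
  then show ?thesis by (simp add: h_def)
qed

text \<open>
  The neighbourhood restricts only relative positions. The velocities are components of the field as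
  well, and this bound provides the second condition for the field to be uniformly bounded along a solution.
\<close>
lemma velocity_component_le:
  assumes l: "0 < l" "l < sqrt 2 - 1" and y: "solves (nbody_field G m) y (ball 0 r)" "y 0 = initial_state q0 v0"
    and r: "r \<le> inverse (L_max G m q0 v0 l)" and t: "t \<in> ball 0 r"
  shows "norm (y t $ Inr (i, k)) \<le> (\<Sum>i\<in>UNIV. norm (v0 $ i) + r * (eta l * K_fun G m q0 i))"
proof -
  have inb: "of_real x * t \<in> ball 0 r" if "x \<in> {0..1}" for x :: real
    using that t mult_left_le_one_le[of "norm t" x] by (auto simp: norm_mult)
  have pos: "eta l * K_fun G m q0 i \<ge> 0" for i
    using eta_pos[of l] K_fun_pos[OF card q0 G m, of i] l by simp
  have "norm (vel_part (y t) $ i - vel_part (y 0) $ i) \<le> norm t * (eta l * K_fun G m q0 i)"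
    by (rule velocity_deviation_le[OF _ l(2) y(1) t solution_stays_near[OF l y r inb]]) (use l in auto)
  also have "\<dots> \<le> r * (eta l * K_fun G m q0 i)"
    using t pos by (intro mult_right_mono) auto
  finally have "norm (vel_part (y t) $ i) \<le> norm (v0 $ i) + r * (eta l * K_fun G m q0 i)"
    using norm_triangle_ineq2[of "vel_part (y t) $ i" "vel_part (y 0) $ i"] y(2)
    by (simp add: initial_state_def norm_cvec)
  also have "\<dots> \<le> (\<Sum>i\<in>UNIV. norm (v0 $ i) + r * (eta l * K_fun G m q0 i))"
  proof (rule member_le_sum)
    have "r \<ge> 0" using t by (auto intro: order_trans[OF norm_ge_zero less_imp_le])
    then show "0 \<le> norm (v0 $ i) + r * (eta l * K_fun G m q0 i)" for i using pos by simp
  qed auto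
  finally show ?thesis
    using order_trans[OF Finite_Cartesian_Product.norm_nth_le[of "vel_part (y t) $ i" k]] by simp
qed

text \<open>
  There is room between \<open>l\<close> and \<open>sqrt 2 - 1\<close>: for an intermediate \<open>l'\<close> a ball of fixed radius around
  each point of the smaller neighbourhood lies in the larger one, where the force bound holds with \<open>eta l'\<close>.
\<close>
lemma nbody_field_bounded_near:
  assumes l: "0 < l" "l < sqrt 2 - 1"
  shows "\<exists>W d B. holo_field (nbody_field G m) W \<and> d > 0 \<and> B > 0 \<and>
    (\<forall>z. pos_part z \<in> complex_nbhd l q0 \<longrightarrow> (\<forall>i k. norm (z $ Inr (i, k)) \<le> V) \<longrightarrow>
       bounded_on_ball (nbody_field G m) W d B z)"
proof -
  define l' where "l' = (l + (sqrt 2 - 1)) / 2"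
  have l': "l < l'" "l' < sqrt 2 - 1" "0 \<le> l'" using l by (auto simp: l'_def field_simps)
  define S where "S = (\<lambda>(i, j). norm (q0 $ i - q0 $ j)) ` {(i, j). i < j}"
  have S: "finite S" "S \<noteq> {}"
    using exists_ordered_pair[OF card] by (auto simp: S_def)
  define \<mu> where "\<mu> = Min S"
  have "\<mu> \<in> S" unfolding \<mu>_def using S by (rule Min_in)
  then have \<mu>: "\<mu> > 0" using distinct_positions[OF q0] by (auto simp: S_def)
  have \<mu>_le: "\<mu> \<le> norm (q0 $ i - q0 $ j)" if "i < j" for i j
    unfolding \<mu>_def using S that by (intro Min_le) (auto simp: S_def)
  \<comment> \<open>A move by less than \<open>2 * d\<close> changes each of the three coordinates of a body by less than \<open>2 * d\<close>,
  hence a difference of two positions by at most \<open>12 * d\<close>; this must not exceed \<open>(l' - l) * \<mu>\<close>.\<close>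
  define d where "d = (l' - l) * \<mu> / 12"
  have d: "d > 0" using \<mu> l' by (simp add: d_def)
  define W where "W = {y :: complex^(('n \<times> 3) + ('n \<times> 3)). pos_part y \<in> complex_nbhd l' q0}"
  have KK: "eta l' * K_fun G m q0 i \<ge> 0" for i
    using eta_pos[of l'] K_fun_pos[OF card q0 G m, of i] l' by simp
  define B where "B = 1 + \<bar>V\<bar> + 2 * d + (\<Sum>i\<in>UNIV. eta l' * K_fun G m q0 i)"
  have sumK: "eta l' * K_fun G m q0 i \<le> (\<Sum>i\<in>UNIV. eta l' * K_fun G m q0 i)" for i
    using KK by (intro member_le_sum) auto
  have B: "B > 0" unfolding B_def using d sum_nonneg[of UNIV "\<lambda>i. eta l' * K_fun G m q0 i"] KK by simp
  have "bounded_on_ball (nbody_field G m) W d B z"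
    if z: "pos_part z \<in> complex_nbhd l q0" "\<forall>i k. norm (z $ Inr (i, k)) \<le> V" for z
  proof -
    have comp: "norm (w $ a - z $ a) < 2 * d" if "w \<in> ball z (2 * d)" for w a
      using that Finite_Cartesian_Product.norm_nth_le[of "w - z" a] by (simp add: dist_norm norm_minus_commute)
    have inW: "pos_part w \<in> complex_nbhd l' q0" if w: "w \<in> ball z (2 * d)" for w
      unfolding complex_nbhd_def
    proof (intro CollectI allI impI)
      fix i j :: 'n assume "i < j"
      have pd: "norm (pos_part w $ i - pos_part z $ i) \<le> 6 * d" for i
        using norm_le_CARD_mult[of "pos_part w $ i - pos_part z $ i" "2 * d"] comp[OF w] by (simp add: less_imp_le)
      have "norm ((pos_part z $ i - pos_part z $ j - cvec (q0 $ i) + cvec (q0 $ j))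
          + ((pos_part w $ i - pos_part z $ i) - (pos_part w $ j - pos_part z $ j)))
        \<le> l * norm (q0 $ i - q0 $ j) + (6 * d + 6 * d)"
        using z(1) \<open>i < j\<close> order_trans[OF norm_triangle_ineq4 add_mono[OF pd[of i] pd[of j]]]
        by (intro norm_triangle_mono) (auto simp: complex_nbhd_def)
      also have "6 * d + 6 * d = (l' - l) * \<mu>" by (simp add: d_def)
      also have "\<dots> \<le> (l' - l) * norm (q0 $ i - q0 $ j)"
        using \<mu>_le[OF \<open>i < j\<close>] l' by (intro mult_left_mono) auto
      finally show "norm (pos_part w $ i - pos_part w $ j - cvec (q0 $ i) + cvec (q0 $ j))
          \<le> l' * norm (q0 $ i - q0 $ j)"
        by (simp add: algebra_simps)
    qed
    have "norm (nbody_field G m w $ a) \<le> B" if w: "w \<in> ball z (2 * d)" for w a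
    proof -
      have "norm (w $ Inr (i, k)) \<le> B" for i k
      proof -
        have "norm (w $ Inr (i, k)) \<le> V + 2 * d"
          using less_imp_le[OF comp[OF w, of "Inr (i, k)"]] z(2)[rule_format, of i k]
            norm_triangle_ineq2[of "w $ Inr (i, k)" "z $ Inr (i, k)"]
          by linarith
        then show ?thesis
          using sum_nonneg[of UNIV "\<lambda>i. eta l' * K_fun G m q0 i"] KK by (simp add: B_def)
      qed
      moreover have "norm (grav_acc G m (pos_part w) i $ k) \<le> B" for i k
      proof -
        have "norm (grav_acc G m (pos_part w) i $ k) \<le> norm (grav_acc G m (pos_part w) i)"
          by (rule Finite_Cartesian_Product.norm_nth_le)
        also have "\<dots> \<le> eta l' * K_fun G m q0 i"
          by (rule norm_grav_acc_le[OF inW[OF w] l'(3,2) q0 G m])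
        also have "\<dots> \<le> B" using sumK[of i] d by (simp add: B_def)
        finally show ?thesis .
      qed
      ultimately show ?thesis
        using all_state_index[of "\<lambda>a. norm (nbody_field G m w $ a) \<le> B"] by simp
    qed
    then show ?thesis using inW by (auto simp: bounded_on_ball_def W_def)
  qed
  moreover have "holo_field (nbody_field G m) W"
    unfolding W_def by (rule holo_field_nbody[OF l'(3,2) q0])
  ultimately show ?thesis using d B by blast
qed

end

section \<open>Holomorphic solutions on the closed disk\<close>

lemma holomorphic_solution_of_solves:
  assumes y: "solves (nbody_field G m) y U" and y0: "y 0 = initial_state q0 v0"
  shows "holomorphic_solution G m q0 v0 U (\<lambda>t. pos_part (y t)) (\<lambda>t. vel_part (y t))"
  unfolding holomorphic_solution_def pos_part_nth vel_part_nth
proof (intro conjI allI ballI)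
  show "(\<lambda>t. y t $ Inl (i, k)) holomorphic_on U" "(\<lambda>t. y t $ Inr (i, k)) holomorphic_on U" for i k
    using solves_holo_curve[OF y] by (simp_all add: holo_curve_def)
  fix t i k assume "t \<in> U"
  then have "((\<lambda>s. y s $ Inl (i, k)) has_field_derivative y t $ Inr (i, k)) (at t)"
    "((\<lambda>s. y s $ Inr (i, k)) has_field_derivative grav_acc G m (pos_part (y t)) i $ k) (at t)"
    using y unfolding solves_nbody_iff by blast+
  then show "((\<lambda>s. y s $ Inl (i, k)) has_field_derivative y t $ Inr (i, k)) (at t within U)"
    "((\<lambda>s. y s $ Inr (i, k)) has_field_derivative grav_acc G m (pos_part (y t)) i $ k) (at t within U)"
    by (blast intro: has_field_derivative_at_within)+
qed (simp_all add: y0 initial_state_def)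

text \<open>
  Derivatives within a closed disk are ordinary derivatives only at interior points. On the boundary
  circle uniqueness has to come from continuity.
\<close>
lemma solves_of_holomorphic_solution:
  assumes sol: "holomorphic_solution G m q0 v0 S q v"
  shows "solves (nbody_field G m) (\<lambda>t. join_state (q t) (v t)) (interior S)"
    and "join_state (q 0) (v 0) = initial_state q0 v0"
proof -
  show "solves (nbody_field G m) (\<lambda>t. join_state (q t) (v t)) (interior S)"
    unfolding solves_nbody_iff join_state_nth parts_join
  proof (intro ballI allI)
    fix t i k assume t: "t \<in> interior S"
    then have "t \<in> S" using interior_subset by blast
    then show "((\<lambda>s. q s $ i $ k) has_field_derivative v t $ i $ k) (at t) \<and>
        ((\<lambda>s. v s $ i $ k) has_field_derivative grav_acc G m (q t) i $ k) (at t)"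
      using sol unfolding holomorphic_solution_def at_within_interior[OF t, symmetric] by blast
  qed
  show "join_state (q 0) (v 0) = initial_state q0 v0"
    using sol by (simp add: holomorphic_solution_def initial_state_def vec_eq_iff all_state_index)
qed

theorem theorem2:
  fixes G l :: real
    and m :: "real^'n::{finite,linorder}"
    and q0 v0 :: "real^3^'n::{finite,linorder}"
  assumes "CARD('n) \<ge> 2"
    and "G > 0"
    and "\<And>i. m $ i > 0"
    and "0 < l" and "l < sqrt 2 - 1"
    and "q0 \<notin> collision_set"
  shows "\<exists>q v.
    (\<exists>U. open U \<and> time_disk G m q0 v0 l \<subseteq> U \<and> holomorphic_solution G m q0 v0 U q v) \<and>
    (\<forall>q' v'. holomorphic_solution G m q0 v0 (time_disk G m q0 v0 l) q' v' \<longrightarrow>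
       (\<forall>t\<in>time_disk G m q0 v0 l. q' t = q t \<and> v' t = v t)) \<and>
    (\<forall>t\<in>time_disk G m q0 v0 l.
       (\<forall>i j. i < j \<longrightarrow>
          norm (q t $ i - q t $ j - cvec (q0 $ i) + cvec (q0 $ j))
            \<le> norm t * norm (v0 $ i - v0 $ j) + (norm t)\<^sup>2 / 2 * M_fun G m q0 l i j \<and>
          norm (v t $ i - v t $ j - cvec (v0 $ i) + cvec (v0 $ j))
            \<le> M_fun G m q0 l i j * norm t) \<and>
       q t \<in> complex_nbhd l q0)"
proof -
  note bodies = assms(1-3,6)
  note l = assms(4,5)
  let ?F = "nbody_field G m"
  define R where "R = inverse (L_max G m q0 v0 l)"
  have D: "time_disk G m q0 v0 l = cball 0 R" by (auto simp: time_disk_def R_def)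
  obtain i1 j1 :: 'n where "i1 < j1" using exists_ordered_pair[OF assms(1)] by auto
  from time_bounds(1)[OF bodies l this] have R: "R > 0" by (simp add: R_def)
  have KK: "eta l * K_fun G m q0 i \<ge> 0" for i
    using eta_pos[of l] K_fun_pos[OF assms(1,6,2,3), of i] l by simp
  define V where "V = (\<Sum>i\<in>UNIV. norm (v0 $ i) + R * (eta l * K_fun G m q0 i))"
  define Z where "Z = {z. pos_part z \<in> complex_nbhd l q0 \<and> (\<forall>i k. norm (z $ Inr (i, k)) \<le> V)}"
  obtain W d B where F: "holo_field ?F W" and d: "d > 0" and B: "B > 0"
    and bd: "\<And>z. z \<in> Z \<Longrightarrow> bounded_on_ball ?F W d B z"
    using nbody_field_bounded_near[OF bodies l, of V] unfolding Z_def by auto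
  have z0: "initial_state q0 v0 \<in> Z"
  proof -
    have "norm (v0 $ i $ k) \<le> V" for i k
    proof -
      have "norm (v0 $ i $ k) \<le> norm (v0 $ i) + R * (eta l * K_fun G m q0 i)"
        using Finite_Cartesian_Product.norm_nth_le[of "v0 $ i" k]
          mult_nonneg_nonneg[OF less_imp_le[OF R] KK[of i]] by linarith
      also have "\<dots> \<le> V" unfolding V_def using KK R by (intro member_le_sum) auto
      finally show ?thesis .
    qed
    then show ?thesis
      using initial_in_nbhd[of l q0] l by (simp add: Z_def initial_state_def cvec_def)
  qed
  have "\<exists>\<rho>>R. \<exists>y. solves ?F y (ball 0 \<rho>) \<and> y 0 = initial_state q0 v0"
  proof (rule solution_beyond_radius[OF F bd d B R z0])
    fix r and y :: "complex \<Rightarrow> complex^(('n \<times> 3) + ('n \<times> 3))"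
    assume r: "0 < r" "r \<le> R" and y: "solves ?F y (ball 0 r)" "y 0 = initial_state q0 v0"
    have "(\<Sum>i\<in>UNIV. norm (v0 $ i) + r * (eta l * K_fun G m q0 i)) \<le> V"
      unfolding V_def using r KK by (intro sum_mono add_left_mono mult_right_mono) auto
    then show "y ` ball 0 r \<subseteq> Z"
      using solution_stays_near[OF bodies l y r(2)[unfolded R_def]]
        velocity_component_le[OF bodies l y r(2)[unfolded R_def]]
      by (fastforce simp: Z_def intro: order_trans)
  qed
  then obtain \<rho> y where \<rho>: "\<rho> > R" and y: "solves ?F y (ball 0 \<rho>)" and y0: "y 0 = initial_state q0 v0"
    by auto
  have sub: "cball 0 R \<subseteq> ball 0 \<rho>" using \<rho> by auto
  have yR: "solves ?F y (ball 0 R)" using y sub ball_subset_cball by (meson solves_subset order_trans)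
  have cl: "closure (ball 0 R) = (cball 0 R :: complex set)" using R by simp
  have conty: "continuous_on (cball 0 R) y"
    using holo_curve_continuous[OF solves_holo_curve[OF y]] sub continuous_on_subset by blast
  \<comment> \<open>The a priori bound concerns the open disk; the boundary circle follows because the neighbourhood is closed.\<close>
  have near: "pos_part (y t) \<in> complex_nbhd l q0" if "t \<in> cball 0 R" for t
  proof -
    have "(\<lambda>t. pos_part (y t)) ` closure (ball 0 R) \<subseteq> complex_nbhd l q0"
    proof (rule image_closure_subset)
      show "continuous_on (closure (ball 0 R)) (\<lambda>t. pos_part (y t))"
        unfolding cl using continuous_pos_part[OF solves_holo_curve[OF y]] sub continuous_on_subset by blast
      show "(\<lambda>t. pos_part (y t)) ` ball 0 R \<subseteq> complex_nbhd l q0"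
        using solution_stays_near[OF bodies l yR y0] by (auto simp: R_def)
    qed (rule closed_complex_nbhd)
    then show ?thesis using that unfolding cl by blast
  qed
  have uniq: "join_state (q' t) (v' t) = y t"
    if sol: "holomorphic_solution G m q0 v0 (cball 0 R) q' v'" and t: "t \<in> cball 0 R" for q' v' t
  proof -
    let ?y = "\<lambda>t. join_state (q' t) (v' t)"
    have y': "solves ?F ?y (ball 0 R)" "?y 0 = initial_state q0 v0"
      using solves_of_holomorphic_solution[OF sol] by auto
    have eq: "y s = ?y s" if "s \<in> ball 0 R" for s
      by (rule uniqueness[OF F _ d B, of y 0 "ball 0 R"]) (use bd z0 y0 y' yR R that in auto)
    have "continuous_on (cball 0 R) (\<lambda>t. ?y t $ a)" for a
    proof -
      have "\<forall>a. continuous_on (cball 0 R) (\<lambda>t. ?y t $ a)"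
        unfolding all_state_index using sol
        by (auto simp: holomorphic_solution_def intro: holomorphic_on_imp_continuous_on)
      then show ?thesis ..
    qed
    then have "continuous_on (closure (ball 0 R)) (\<lambda>t. ?y t - y t)"
      unfolding cl by (intro continuous_on_diff continuous_on_vec_components conty)
    from continuous_constant_on_closure[OF this, of 0 t] show ?thesis
      using eq t unfolding cl by simp
  qed
  show ?thesis
    unfolding D
  proof (rule exI[of _ "\<lambda>t. pos_part (y t)"], rule exI[of _ "\<lambda>t. vel_part (y t)"],
      intro conjI allI impI ballI)
    show "\<exists>U. open U \<and> cball 0 R \<subseteq> U \<and> holomorphic_solution G m q0 v0 U (\<lambda>t. pos_part (y t)) (\<lambda>t. vel_part (y t))"
      using sub holomorphic_solution_of_solves[OF y y0] by (intro exI[of _ "ball 0 \<rho>"]) auto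
  next
    fix q' v' :: "complex \<Rightarrow> complex^3^'n::{finite,linorder}" and t :: complex
    assume "holomorphic_solution G m q0 v0 (cball 0 R) q' v'" "t \<in> cball 0 R"
    from uniq[OF this] show "q' t = pos_part (y t)" "v' t = vel_part (y t)"
      by (metis parts_join)+
  next
    fix t i j assume t: "t \<in> cball (0 :: complex) R" and "i < (j :: 'n)"
    have ray: "pos_part (y (of_real x * t)) \<in> complex_nbhd l q0" if "x \<in> {0..1}" for x :: real
      by (rule near) (use that t mult_left_le_one_le[of "norm t" x] in \<open>auto simp: norm_mult\<close>)
    note est = pair_deviation_le[OF bodies less_imp_le[OF l(1)] l(2) y subsetD[OF sub t] ray, of i j]
    show "norm (pos_part (y t) $ i - pos_part (y t) $ j - cvec (q0 $ i) + cvec (q0 $ j))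
            \<le> norm t * norm (v0 $ i - v0 $ j) + (norm t)\<^sup>2 / 2 * M_fun G m q0 l i j"
      using est(2) y0 by (simp add: initial_state_def norm_cvec flip: cvec_diff)
    show "norm (vel_part (y t) $ i - vel_part (y t) $ j - cvec (v0 $ i) + cvec (v0 $ j))
            \<le> M_fun G m q0 l i j * norm t"
      using est(1) y0 by (simp add: initial_state_def)
  qed (rule near)
qed

end
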